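(* (a) The Hamiltonian equation of motion generated by $F\in C^\infty(\mathfrak g_R^* )$ is $$\dot K=\tfrac12[R(dF(K)),K]-\tfrac12R^*[K,dF(K)].$$ In particular, for the Hamiltonian $H_j(K)=\frac1{2(j+1)}\mathrm{tr}(K^{j+1})$, $j=1,2,\ldots$, the corresponding equation is the Lax equation $$\dot K=\tfrac12[\Pi_{\mathfrak l}K^j,K].$$ (b) The family of functions $H_j(K)$, $j=1,2,\ldots$, Poisson commute with respect to $\{\cdot,\cdot\}_R$.
   Context: Let $\mathcal H=L^2(\mathbb R)$ (real-valued functions) and let $\mathfrak g$ be the Lie algebra of Hilbert-Schmidt operators on $\mathcal H$ (integral operators with kernel $A(x,y)\in L^2(\mathbb R^2)$), with bracket $[A,B]=A\circ B-B\circ A$ and the non-degenerate ad-invariant pairing $(A,B)=\int_{\mathbb R^2}A(x,y)B(y,x)\,dx\,dy$. Let $\mathfrak l\subset\mathfrak g$ be the Volterra operators $(A\varphi)(x)=\int_{-\infty}^xA(x,y)\varphi(y)\,dy$ (kernel vanishing for $y>x$) and $\mathfrak k=\{B\in\mathfrak g:B^*=-B\}$. Then $\mathfrak g=\mathfrak l\oplus\mathfrak k$ with projections $\Pi_{\mathfrak l},\Pi_{\mathfrak k}$. Put $R=\Pi_{\mathfrak l}-\Pi_{\mathfrak k}$; the formula $[A,B]_R=\frac12([R(A),B]+[A,R(B)])$ defines a second Lie bracket on $\mathfrak g$, and $\mathfrak g_R$ denotes $\mathfrak g$ with this bracket. Dual maps such as $R^*$ are computed with respect to the pairing $(\cdot,\cdot)$.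 Identify $\mathfrak g_R^*\simeq\mathfrak g$ via the pairing. For $F\in C^\infty(\mathfrak g_R^* )$, $dF(K)\in\mathfrak g$ is defined by $\frac{d}{dt}|_{t=0}F(K+tK')=(dF(K),K')$. The Lie-Poisson bracket is $\{F_1,F_2\}_R(K)=(K,[dF_1(K),dF_2(K)]_R)$. The Hamiltonian equation of motion generated by $H$ is the one for which $\frac{d}{dt}F(K(t))=\{F,H\}_R(K(t))$ for all $F$. *)

theory Defs
  imports "HOL-Analysis.Analysis"
begin

section \<open>The real Hilbert space of square-integrable functions\<close>

definition square_integrable :: "('a::euclidean_space \<Rightarrow> real) \<Rightarrow> bool" where
  "square_integrable f \<longleftrightarrow> f \<in> borel_measurable borel \<and> integrable lborel (\<lambda>x. (f x)\<^sup>2)"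

definition L2_eq :: "('a::euclidean_space \<Rightarrow> real) \<Rightarrow> ('a \<Rightarrow> real) \<Rightarrow> bool" where
  "L2_eq f g \<longleftrightarrow> square_integrable f \<and> square_integrable g \<and> (AE x in lborel. f x = g x)"

lemma square_integrable_zero: "square_integrable (\<lambda>_. 0)"
  by (simp add: square_integrable_def)

lemma square_integrable_mult:
  assumes "square_integrable f" "square_integrable g"
  shows "integrable lborel (\<lambda>x. f x * g x)"
proof (rule Bochner_Integration.integrable_bound)
  show "integrable lborel (\<lambda>x. (f x)\<^sup>2 + (g x)\<^sup>2)"
    using assms by (auto simp: square_integrable_def)
  show "(\<lambda>x. f x * g x) \<in> borel_measurable lborel"
    using assms by (auto simp: square_integrable_def)
  have "\<bar>a * b\<bar> \<le> a\<^sup>2 + b\<^sup>2" for a b :: real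
  proof -
    have "0 \<le> (\<bar>a\<bar> - \<bar>b\<bar>)\<^sup>2" by simp
    then have "2 * (\<bar>a\<bar> * \<bar>b\<bar>) \<le> a\<^sup>2 + b\<^sup>2"
      by (simp add: power2_diff)
    moreover have "0 \<le> \<bar>a\<bar> * \<bar>b\<bar>" by simp
    ultimately show ?thesis unfolding abs_mult by linarith
  qed
  then show "AE x in lborel. norm (f x * g x) \<le> norm ((f x)\<^sup>2 + (g x)\<^sup>2)"
    by simp
qed

lemma square_integrable_add:
  assumes "square_integrable f" "square_integrable g"
  shows "square_integrable (\<lambda>x. f x + g x)"
proof -
  have "(\<lambda>x. (f x + g x)\<^sup>2) = (\<lambda>x. (f x)\<^sup>2 + (g x)\<^sup>2 + 2 * (f x * g x))"
    by (auto simp: power2_sum)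
  then show ?thesis
    using assms square_integrable_mult[OF assms] by (auto simp: square_integrable_def)
qed

lemma square_integrable_scale:
  assumes "square_integrable f"
  shows "square_integrable (\<lambda>x. c * f x)"
  using assms by (auto simp: square_integrable_def power_mult_distrib)

lemma square_integrable_uminus:
  assumes "square_integrable f"
  shows "square_integrable (\<lambda>x. - f x)"
  using assms by (auto simp: square_integrable_def)

lemma square_integrable_diff:
  assumes "square_integrable f" "square_integrable g"
  shows "square_integrable (\<lambda>x. f x - g x)"
  using square_integrable_add[OF assms(1) square_integrable_uminus[OF assms(2)]] by simp

lemma part_equivp_L2_eq: "part_equivp (L2_eq :: ('a::euclidean_space \<Rightarrow> real) \<Rightarrow> _)"
proof (rule part_equivpI)
  show "\<exists>f :: 'a \<Rightarrow> real. L2_eq f f"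
    by (rule exI[of _ "\<lambda>_. 0"]) (simp add: L2_eq_def square_integrable_zero)
  show "symp (L2_eq :: ('a \<Rightarrow> real) \<Rightarrow> _)"
  proof (rule sympI)
    fix f g :: "'a \<Rightarrow> real"
    assume fg: "L2_eq f g"
    then have "AE x in lborel. f x = g x" by (simp add: L2_eq_def)
    then have "AE x in lborel. g x = f x" by eventually_elim simp
    with fg show "L2_eq g f" by (simp add: L2_eq_def)
  qed
  show "transp (L2_eq :: ('a \<Rightarrow> real) \<Rightarrow> _)"
  proof (rule transpI)
    fix f g h :: "'a \<Rightarrow> real"
    assume "L2_eq f g" "L2_eq g h"
    moreover from this have "AE x in lborel. f x = g x" "AE x in lborel. g x = h x"
      by (auto simp: L2_eq_def)
    then have "AE x in lborel. f x = h x"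
      by eventually_elim simp
    ultimately show "L2_eq f h" by (simp add: L2_eq_def)
  qed
qed

quotient_type (overloaded) 'a L2 = "'a::euclidean_space \<Rightarrow> real" / partial: L2_eq
  by (rule part_equivp_L2_eq)

instantiation L2 :: (euclidean_space) real_vector
begin

lift_definition zero_L2 :: "'a L2" is "\<lambda>_. 0"
  by (simp add: L2_eq_def square_integrable_zero)

lift_definition plus_L2 :: "'a L2 \<Rightarrow> 'a L2 \<Rightarrow> 'a L2" is "\<lambda>f g x. f x + g x"
  by (auto simp: L2_eq_def square_integrable_add)

lift_definition minus_L2 :: "'a L2 \<Rightarrow> 'a L2 \<Rightarrow> 'a L2" is "\<lambda>f g x. f x - g x"
  by (auto simp: L2_eq_def square_integrable_diff)

lift_definition uminus_L2 :: "'a L2 \<Rightarrow> 'a L2" is "\<lambda>f x. - f x"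
  by (auto simp: L2_eq_def square_integrable_uminus)

lift_definition scaleR_L2 :: "real \<Rightarrow> 'a L2 \<Rightarrow> 'a L2" is "\<lambda>c f x. c * f x"
  by (auto simp: L2_eq_def square_integrable_scale)

instance
  by standard
    (transfer; auto simp: L2_eq_def algebra_simps
      intro: square_integrable_add square_integrable_scale square_integrable_zero
        square_integrable_diff square_integrable_uminus)+

end

instantiation L2 :: (euclidean_space) real_inner
begin

lift_definition inner_L2 :: "'a L2 \<Rightarrow> 'a L2 \<Rightarrow> real" is "\<lambda>f g. \<integral>x. f x * g x \<partial>lborel"
  by (intro integral_cong_AE) (auto simp: L2_eq_def square_integrable_def)

definition norm_L2 :: "'a L2 \<Rightarrow> real" where
  "norm_L2 f = sqrt (inner f f)"

definition dist_L2 :: "'a L2 \<Rightarrow> 'a L2 \<Rightarrow> real" where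
  "dist_L2 f g = norm (f - g)"

definition sgn_L2 :: "'a L2 \<Rightarrow> 'a L2" where
  "sgn_L2 f = f /\<^sub>R norm f"

definition uniformity_L2 :: "('a L2 \<times> 'a L2) filter" where
  "uniformity_L2 = (INF e\<in>{0 <..}. principal {(f, g). dist f g < e})"

definition open_L2 :: "'a L2 set \<Rightarrow> bool" where
  "open_L2 U \<longleftrightarrow> (\<forall>f\<in>U. eventually (\<lambda>(f', g). f' = f \<longrightarrow> g \<in> U) uniformity)"

instance
proof
  fix f g h :: "'a L2" and c :: real
  show "inner f g = inner g f"
    by transfer (simp add: mult.commute)
  show "inner (f + g) h = inner f h + inner g h"
    by transfer (simp add: L2_eq_def distrib_right square_integrable_mult)
  show "inner (c *\<^sub>R f) g = c * inner f g"
    by transfer (simp add: mult.assoc)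
  show "0 \<le> inner f f"
    by transfer simp
  show "inner f f = 0 \<longleftrightarrow> f = 0"
    by transfer
      (auto simp: L2_eq_def square_integrable_def power2_eq_square integral_nonneg_eq_0_iff_AE)
qed (simp_all add: norm_L2_def dist_L2_def sgn_L2_def uniformity_L2_def open_L2_def)

end

section \<open>Smooth functions on a normed space\<close>

text \<open>
  The function \<open>F\<close> is of class \<open>C\<^sup>\<infinity>\<close> in the sense of Frechet: \<open>D k x\<close> is the \<open>k\<close>-th derivative
  at \<open>x\<close>, a bounded \<open>k\<close>-linear form applied to lists of \<open>k\<close> vectors, and \<open>D (Suc k)\<close> is the
  Frechet derivative of \<open>D k\<close> with respect to the norm of bounded \<open>k\<close>-linear forms.
\<close>

definition smooth :: "('a::real_normed_vector \<Rightarrow> real) \<Rightarrow> bool" where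
  "smooth F \<longleftrightarrow> (\<exists>D :: nat \<Rightarrow> 'a \<Rightarrow> 'a list \<Rightarrow> real.
     (\<forall>x. D 0 x [] = F x) \<and>
     (\<forall>k x vs i. length vs = k \<and> i < k \<longrightarrow> linear (\<lambda>v. D k x (vs[i := v]))) \<and>
     (\<forall>k x. \<exists>C. \<forall>vs. length vs = k \<longrightarrow> \<bar>D k x vs\<bar> \<le> C * (\<Prod>v\<leftarrow>vs. norm v)) \<and>
     (\<forall>k x. \<forall>e>0. \<exists>d>0. \<forall>h vs. length vs = k \<and> norm h < d \<longrightarrow>
        \<bar>D k (x + h) vs - D k x vs - D (Suc k) x (h # vs)\<bar> \<le> e * norm h * (\<Prod>v\<leftarrow>vs. norm v)))"

section \<open>Hilbert-Schmidt operators\<close>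

text \<open>
  A Hilbert-Schmidt operator is identified with its kernel, so that the norm of \<open>hs\<close> is the
  Hilbert-Schmidt norm. The operator itself is \<open>int_op A\<close>, and \<open>kernel\<close> is the inverse of the
  injective map \<open>int_op\<close> on its range.
\<close>

type_synonym hs = "(real \<times> real) L2"

definition int_op :: "hs \<Rightarrow> real L2 \<Rightarrow> real L2" where
  "int_op A \<phi> = abs_L2 (\<lambda>x. \<integral>y. rep_L2 A (x, y) * rep_L2 \<phi> y \<partial>lborel)"

definition kernel :: "(real L2 \<Rightarrow> real L2) \<Rightarrow> hs" where
  "kernel T = (THE A. int_op A = T)"

definition hs_comp :: "hs \<Rightarrow> hs \<Rightarrow> hs" where
  "hs_comp A B = kernel (int_op A \<circ> int_op B)"

text \<open>Only used for \<open>j \<ge> 1\<close>: the identity operator is not Hilbert-Schmidt.\<close>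

definition hs_power :: "hs \<Rightarrow> nat \<Rightarrow> hs" where
  "hs_power A j = kernel (int_op A ^^ j)"

definition bracket :: "hs \<Rightarrow> hs \<Rightarrow> hs" where
  "bracket A B = hs_comp A B - hs_comp B A"

definition pairing :: "hs \<Rightarrow> hs \<Rightarrow> real" where
  "pairing A B = (\<integral>(x, y). rep_L2 A (x, y) * rep_L2 B (y, x) \<partial>lborel)"

definition orthonormal_basis :: "'a::real_inner set \<Rightarrow> bool" where
  "orthonormal_basis E \<longleftrightarrow>
     (\<forall>e\<in>E. norm e = 1) \<and> pairwise orthogonal E \<and> closure (span E) = UNIV"

text \<open>Meaningful for trace-class operators, where the sum does not depend on the basis.\<close>

definition trace :: "('a::real_inner \<Rightarrow> 'a) \<Rightarrow> real" where
  "trace T = (THE s. \<forall>E. orthonormal_basis E \<longrightarrow> ((\<lambda>e. inner (T e) e) has_sum s) E)"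

section \<open>The splitting into Volterra and skew-adjoint operators\<close>

definition volterra :: "hs set" where
  "volterra = {A. AE (x, y) in lborel. y > x \<longrightarrow> rep_L2 A (x, y) = 0}"

definition skew :: "hs set" where
  "skew = {B. adjoint (int_op B) = (\<lambda>\<phi>. - int_op B \<phi>)}"

definition proj_l :: "hs \<Rightarrow> hs" where
  "proj_l A = (THE L. L \<in> volterra \<and> A - L \<in> skew)"

definition proj_k :: "hs \<Rightarrow> hs" where
  "proj_k A = (THE B. B \<in> skew \<and> A - B \<in> volterra)"

definition R_op :: "hs \<Rightarrow> hs" where
  "R_op A = proj_l A - proj_k A"

definition bracket_R :: "hs \<Rightarrow> hs \<Rightarrow> hs" where
  "bracket_R A B = (1/2) *\<^sub>R (bracket (R_op A) B + bracket A (R_op B))"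

text \<open>The dual map with respect to \<open>pairing\<close>, not to the inner product of \<open>hs\<close>.\<close>

definition dual_map :: "(hs \<Rightarrow> hs) \<Rightarrow> hs \<Rightarrow> hs" where
  "dual_map T = (THE S. \<forall>A B. pairing (T A) B = pairing A (S B))"

section \<open>The Lie-Poisson structure\<close>

text \<open>Functions on the dual space are functions on \<open>hs\<close>, the dual being identified via \<open>pairing\<close>.\<close>

definition grad :: "(hs \<Rightarrow> real) \<Rightarrow> hs \<Rightarrow> hs" where
  "grad F K = (THE A. \<forall>K'. ((\<lambda>t. F (K + t *\<^sub>R K')) has_real_derivative pairing A K') (at 0))"

definition poisson_R :: "(hs \<Rightarrow> real) \<Rightarrow> (hs \<Rightarrow> real) \<Rightarrow> hs \<Rightarrow> real" where
  "poisson_R F1 F2 K = pairing K (bracket_R (grad F1 K) (grad F2 K))"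

definition hamiltonian_motion :: "(hs \<Rightarrow> real) \<Rightarrow> real set \<Rightarrow> (real \<Rightarrow> hs) \<Rightarrow> bool" where
  "hamiltonian_motion H I K \<longleftrightarrow>
     (\<forall>t\<in>I. K differentiable (at t within I) \<and>
        (\<forall>F. smooth F \<longrightarrow>
           ((\<lambda>s. F (K s)) has_real_derivative poisson_R F H (K t)) (at t within I)))"

definition H_fun :: "nat \<Rightarrow> hs \<Rightarrow> real" where
  "H_fun j K = 1 / (2 * (real j + 1)) * trace (int_op K ^^ (j + 1))"

end

theory Submission
  imports Defs
begin

text \<open>
  Once the pairing is known to be a non-degenerate, symmetric and invariant trace form, the theorem
  is formal. By invariance, \<open>(K, [R dF, dH] + [dF, R dH])\<close> equals
  \<open>(dF, [R dH, K] - R\<^sup>* [K, dH])\<close>, so the Poisson bracket is the value of \<open>dF\<close> on the vector field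
  in the statement (\<open>poisson_R_eq\<close>). If \<open>K\<close> is a curve along which this describes the derivative
  of every smooth \<open>F\<close>, then the linear functions \<open>F = (A, \<cdot>)\<close>, whose gradient is \<open>A\<close>, identify
  the derivative of \<open>K\<close> by non-degeneracy; the converse is the chain rule
  (\<open>hamiltonian_motion_iff\<close>). The gradient of \<open>H\<^sub>j\<close> is half of \<open>K\<^sup>j\<close>. It commutes with \<open>K\<close>, so that
  the term with \<open>R\<^sup>*\<close> vanishes and, because \<open>R = 2 \<Pi>\<^sub>l - 1\<close>, what is left is the Lax equation
  (\<open>hamiltonian_field_H_fun\<close>). The bracket of \<open>H\<^sub>i\<close> and \<open>H\<^sub>j\<close> is a multiple of
  \<open>([K, K\<^sup>i], \<Pi>\<^sub>l K\<^sup>j) = 0\<close>.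

  What has to be built is the analysis below this argument. The space of kernels is complete
  (Riesz-Fischer), hence every bounded functional on it has a Riesz representative; this gives the
  existence of gradients. The calculus of Hilbert-Schmidt operators is reduced to one identity, which
  is Fubini's theorem: \<open>\<langle>A \<phi>, \<psi>\<rangle>\<close> is the inner product of \<open>A\<close> with the kernel
  \<open>\<psi>(x) \<phi>(y)\<close> of a rank-one operator (\<open>inner_int_op\<close>). The rank-one kernels are total, because they
  contain the indicators of boxes, and those built from an orthonormal basis \<open>E\<close> of
  \<open>L\<^sup>2(\<real>)\<close> form an orthonormal basis of \<open>L\<^sup>2(\<real>\<^sup>2)\<close>. Parseval's identity for them says that
  \<open>\<parallel>A\<parallel>\<^sup>2\<close> is the sum of \<open>\<parallel>A e\<parallel>\<^sup>2\<close> over \<open>e \<in> E\<close>. From this one gets that compositions have kernels,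
  that \<open>tr (A B) = (A, B)\<close> in every basis, and that the pairing is invariant.

  The functions \<open>H\<^sub>j\<close> are smooth since they are diagonal restrictions of bounded multilinear forms.
  The projections onto Volterra and skew operators are explicit: the Volterra part of \<open>A\<close> is the
  strictly lower triangular part of \<open>A + A\<^sup>*\<close>.
\<close>

section \<open>Completeness of the space of square-integrable functions\<close>

lemma square_integrable_rep [simp]: "square_integrable (rep_L2 f)"
proof -
  have "L2_eq (rep_L2 f) (rep_L2 f)"
    by (rule Quotient3_rep_reflp[OF Quotient3_L2])
  then show ?thesis
    by (simp add: L2_eq_def)
qed

lemma rep_L2_measurable [measurable]: "rep_L2 f \<in> borel_measurable borel"
  using square_integrable_rep[of f] by (simp add: square_integrable_def)

lemma abs_rep_L2: "abs_L2 (rep_L2 f) = f"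
  by (rule Quotient3_abs_rep[OF Quotient3_L2])

lemma L2_eqI:
  assumes "AE x in lborel. rep_L2 f x = rep_L2 g x"
  shows "f = g"
  using assms Quotient3_rel_rep[OF Quotient3_L2, of f g]
  by (simp add: L2_eq_def)

lemma rep_abs_L2:
  assumes "square_integrable f"
  shows "AE x in lborel. rep_L2 (abs_L2 f) x = f x"
proof -
  have "L2_eq f f"
    using assms by (simp add: L2_eq_def)
  then have "L2_eq (rep_L2 (abs_L2 f)) f"
    using Quotient3_rep_abs[OF Quotient3_L2] by blast
  then show ?thesis
    by (simp add: L2_eq_def)
qed

lemma rep_L2_add: "AE x in lborel. rep_L2 (f + g) x = rep_L2 f x + rep_L2 g x"
proof -
  have "f + g = abs_L2 (\<lambda>x. rep_L2 f x + rep_L2 g x)"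
    using plus_L2.abs_eq[of "rep_L2 f" "rep_L2 g"] by (simp add: L2_eq_def abs_rep_L2)
  then show ?thesis
    using rep_abs_L2[OF square_integrable_add[OF square_integrable_rep square_integrable_rep]] by simp
qed

lemma rep_L2_diff: "AE x in lborel. rep_L2 (f - g) x = rep_L2 f x - rep_L2 g x"
proof -
  have "f - g = abs_L2 (\<lambda>x. rep_L2 f x - rep_L2 g x)"
    using minus_L2.abs_eq[of "rep_L2 f" "rep_L2 g"] by (simp add: L2_eq_def abs_rep_L2)
  then show ?thesis
    using rep_abs_L2[OF square_integrable_diff[OF square_integrable_rep square_integrable_rep]] by simp
qed

lemma rep_L2_scaleR: "AE x in lborel. rep_L2 (c *\<^sub>R f) x = c * rep_L2 f x"
proof -
  have "c *\<^sub>R f = abs_L2 (\<lambda>x. c * rep_L2 f x)"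
    using scaleR_L2.abs_eq[of "rep_L2 f" c] by (simp add: L2_eq_def abs_rep_L2)
  then show ?thesis
    using rep_abs_L2[OF square_integrable_scale[OF square_integrable_rep]] by simp
qed

lemma inner_L2_rep: "inner f g = (\<integral>x. rep_L2 f x * rep_L2 g x \<partial>lborel)"
  by (rule inner_L2.rep_eq)

lemma integrable_rep_mult [simp, intro]: "integrable lborel (\<lambda>x. rep_L2 f x * rep_L2 g x)"
  by (rule square_integrable_mult) simp_all

lemma inner_L2_abs:
  assumes "square_integrable f" "square_integrable g"
  shows "inner (abs_L2 f) (abs_L2 g) = (\<integral>x. f x * g x \<partial>lborel)"
  unfolding inner_L2_rep
proof (rule integral_cong_AE)
  show "AE x in lborel. rep_L2 (abs_L2 f) x * rep_L2 (abs_L2 g) x = f x * g x"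
    using rep_abs_L2[OF assms(1)] rep_abs_L2[OF assms(2)] by eventually_elim simp
qed (use assms in \<open>auto simp: square_integrable_def\<close>)

lemma nn_integral_norm_L2:
  "(\<integral>\<^sup>+x. ennreal ((rep_L2 f x)\<^sup>2) \<partial>lborel) = ennreal ((norm f)\<^sup>2)"
  unfolding power2_norm_eq_inner inner_L2_rep
  by (simp add: power2_eq_square nn_integral_eq_integral)

lemma nn_integral_dist_L2:
  "(\<integral>\<^sup>+x. ennreal ((rep_L2 f x - rep_L2 g x)\<^sup>2) \<partial>lborel) = ennreal ((norm (f - g))\<^sup>2)"
proof -
  have "(\<integral>\<^sup>+x. ennreal ((rep_L2 f x - rep_L2 g x)\<^sup>2) \<partial>lborel) =
        (\<integral>\<^sup>+x. ennreal ((rep_L2 (f - g) x)\<^sup>2) \<partial>lborel)"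
    by (intro nn_integral_cong_AE eventually_mono[OF rep_L2_diff[of f g]]) simp
  then show ?thesis
    by (simp add: nn_integral_norm_L2)
qed

text \<open>
  The function \<open>\<Sum> 2\<^sup>n \<bar>Y\<^sub>n\<^sub>+\<^sub>1 - Y\<^sub>n\<bar>\<^sup>2\<close> has finite integral, so it is finite almost everywhere, and
  there it dominates \<open>\<Sum> \<bar>Y\<^sub>n\<^sub>+\<^sub>1 - Y\<^sub>n\<bar>\<close> up to a geometric series. The weight \<open>2\<^sup>n\<close> replaces
  Minkowski's inequality for infinite sums.
\<close>

lemma L2_fast_Cauchy_AE_convergent:
  fixes Y :: "nat \<Rightarrow> 'a::euclidean_space L2"
  assumes "\<And>n. norm (Y (Suc n) - Y n) \<le> (1/2)^n"
  shows "AE x in lborel. convergent (\<lambda>n. rep_L2 (Y n) x)"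
proof -
  define d where "d = (\<lambda>n x. 2^n * (rep_L2 (Y (Suc n)) x - rep_L2 (Y n) x)\<^sup>2)"
  have d0: "0 \<le> d n x" for n x
    by (simp add: d_def)
  have [measurable]: "d n \<in> borel_measurable borel" for n
    unfolding d_def by measurable
  have "(\<integral>\<^sup>+x. ennreal (d n x) \<partial>lborel) \<le> ennreal ((1/2)^n)" for n
  proof -
    have "(\<integral>\<^sup>+x. ennreal (d n x) \<partial>lborel) =
          (\<integral>\<^sup>+x. ennreal (2^n) * ennreal ((rep_L2 (Y (Suc n)) x - rep_L2 (Y n) x)\<^sup>2) \<partial>lborel)"
      by (simp add: d_def ennreal_mult)
    also have "\<dots> = ennreal (2^n) * ennreal ((norm (Y (Suc n) - Y n))\<^sup>2)"
      by (simp add: nn_integral_cmult nn_integral_dist_L2)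
    also have "\<dots> = ennreal (2^n * (norm (Y (Suc n) - Y n))\<^sup>2)"
      by (simp add: ennreal_mult)
    also have "\<dots> \<le> ennreal (2^n * ((1/2)^n)\<^sup>2)"
      using assms[of n] by (intro ennreal_leI mult_left_mono power_mono) auto
    also have "2^n * ((1/2)^n)\<^sup>2 = ((1/2)^n :: real)"
      by (simp add: power2_eq_square power_divide)
    finally show ?thesis .
  qed
  then have "(\<integral>\<^sup>+x. (\<Sum>n. ennreal (d n x)) \<partial>lborel) \<le> (\<Sum>n. ennreal ((1/2)^n))"
    by (subst nn_integral_suminf) (auto intro!: suminf_le)
  also have "\<dots> = ennreal (\<Sum>n. (1/2)^n)"
    by (intro suminf_ennreal2 summable_geometric) auto
  also have "\<dots> < \<infinity>"
    by simp
  finally have "AE x in lborel. (\<Sum>n. ennreal (d n x)) \<noteq> \<infinity>"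
    by (intro nn_integral_PInf_AE) auto
  then show ?thesis
  proof eventually_elim
    fix x
    assume "(\<Sum>n. ennreal (d n x)) \<noteq> \<infinity>"
    then have sd: "summable (\<lambda>n. d n x)"
      using d0 by (intro summable_suminf_not_top) auto
    have bd: "\<bar>rep_L2 (Y (Suc n)) x - rep_L2 (Y n) x\<bar> \<le> (1/2)^n + d n x" for n
    proof -
      have am_gm: "a \<le> (1/2)^n + 2^n * a\<^sup>2" if "0 \<le> a" for a :: real
      proof -
        \<comment> \<open>Completing the square gives twice what is needed.\<close>
        have "0 \<le> (1/2)^n * (1 - 2^n * a)\<^sup>2"
          by simp
        also have "(1/2)^n * (1 - 2^n * a)\<^sup>2 = (1/2)^n - 2 * a + 2^n * a\<^sup>2"
          by (simp add: power2_eq_square algebra_simps power_divide)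
        finally show ?thesis
          using that by linarith
      qed
      from am_gm[of "\<bar>rep_L2 (Y (Suc n)) x - rep_L2 (Y n) x\<bar>"] show ?thesis
        by (simp add: d_def)
    qed
    have "summable (\<lambda>n. (1/2)^n + d n x)"
      by (rule summable_add[OF summable_geometric sd]) simp
    then have "summable (\<lambda>n. rep_L2 (Y (Suc n)) x - rep_L2 (Y n) x)"
      by (rule summable_comparison_test') (use bd in auto)
    then have "convergent (\<lambda>n. \<Sum>i<n. rep_L2 (Y (Suc i)) x - rep_L2 (Y i) x)"
      by (simp add: summable_iff_convergent)
    then have "convergent (\<lambda>n. rep_L2 (Y n) x - rep_L2 (Y 0) x)"
      unfolding sum_lessThan_telescope[of "\<lambda>n. rep_L2 (Y n) x"] .
    then have "convergent (\<lambda>n. rep_L2 (Y n) x - rep_L2 (Y 0) x + rep_L2 (Y 0) x)"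
      by (intro convergent_add convergent_const)
    then show "convergent (\<lambda>n. rep_L2 (Y n) x)"
      by simp
  qed
qed

text \<open>
  Riesz-Fischer. A subsequence with rapidly decreasing differences converges almost everywhere, and
  Fatou's lemma turns the pointwise limit into a limit in norm.
\<close>

instance L2 :: (euclidean_space) complete_space
proof
  fix X :: "nat \<Rightarrow> 'a L2"
  assume X: "Cauchy X"
  have "\<exists>r. \<forall>n. (\<forall>i\<ge>r n. \<forall>j\<ge>r n. norm (X i - X j) < (1/2)^n) \<and> r n < r (Suc n)"
  proof (intro dependent_nat_choice)
    show "\<exists>x. \<forall>i\<ge>x. \<forall>j\<ge>x. norm (X i - X j) < (1/2)^0"
      using CauchyD[OF X, of 1] by auto
    fix x n
    obtain N where "\<forall>i\<ge>N. \<forall>j\<ge>N. norm (X i - X j) < (1/2)^Suc n"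
      using CauchyD[OF X, of "(1/2)^Suc n"] by auto
    then show "\<exists>y. (\<forall>i\<ge>y. \<forall>j\<ge>y. norm (X i - X j) < (1/2)^Suc n) \<and> x < y"
      by (intro exI[of _ "max N (Suc x)"]) auto
  qed
  then obtain r where r: "\<And>n i j. i \<ge> r n \<Longrightarrow> j \<ge> r n \<Longrightarrow> norm (X i - X j) < (1/2)^n"
      and "\<And>n. r n < r (Suc n)"
    by blast
  then have mono: "strict_mono r"
    by (simp add: strict_mono_Suc_iff)
  define g where "g = (\<lambda>x. lim (\<lambda>n. rep_L2 (X (r n)) x))"
  have [measurable]: "g \<in> borel_measurable borel"
    unfolding g_def by measurable
  have conv: "AE x in lborel. convergent (\<lambda>n. rep_L2 (X (r n)) x)"
    using mono by (intro L2_fast_Cauchy_AE_convergent less_imp_le[OF r]) (auto simp: strict_mono_less_eq)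
  have fatou: "(\<integral>\<^sup>+x. ennreal ((rep_L2 (X (r n)) x - g x)\<^sup>2) \<partial>lborel) \<le> ennreal (((1/2)^n)\<^sup>2)" for n
  proof -
    have "(\<integral>\<^sup>+x. ennreal ((rep_L2 (X (r n)) x - g x)\<^sup>2) \<partial>lborel) =
          (\<integral>\<^sup>+x. liminf (\<lambda>m. ennreal ((rep_L2 (X (r n)) x - rep_L2 (X (r m)) x)\<^sup>2)) \<partial>lborel)"
    proof (rule nn_integral_cong_AE)
      show "AE x in lborel. ennreal ((rep_L2 (X (r n)) x - g x)\<^sup>2) =
          liminf (\<lambda>m. ennreal ((rep_L2 (X (r n)) x - rep_L2 (X (r m)) x)\<^sup>2))"
        using conv
      proof eventually_elim
        fix x
        assume "convergent (\<lambda>n. rep_L2 (X (r n)) x)"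
        then have "(\<lambda>n. rep_L2 (X (r n)) x) \<longlonglongrightarrow> g x"
          by (simp add: g_def convergent_LIMSEQ_iff)
        then have "(\<lambda>m. ennreal ((rep_L2 (X (r n)) x - rep_L2 (X (r m)) x)\<^sup>2))
            \<longlonglongrightarrow> ennreal ((rep_L2 (X (r n)) x - g x)\<^sup>2)"
          by (intro tendsto_ennrealI tendsto_intros)
        then show "ennreal ((rep_L2 (X (r n)) x - g x)\<^sup>2) =
          liminf (\<lambda>m. ennreal ((rep_L2 (X (r n)) x - rep_L2 (X (r m)) x)\<^sup>2))"
          by (intro lim_imp_Liminf[symmetric]) simp_all
      qed
    qed
    also have "\<dots> \<le> liminf (\<lambda>m. \<integral>\<^sup>+x. ennreal ((rep_L2 (X (r n)) x - rep_L2 (X (r m)) x)\<^sup>2) \<partial>lborel)"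
      by (intro nn_integral_liminf) measurable
    also have "\<dots> = liminf (\<lambda>m. ennreal ((norm (X (r n) - X (r m)))\<^sup>2))"
      by (simp add: nn_integral_dist_L2)
    also have "\<dots> \<le> limsup (\<lambda>m. ennreal ((norm (X (r n) - X (r m)))\<^sup>2))"
      by (intro Liminf_le_Limsup) simp
    also have "\<dots> \<le> ennreal (((1/2)^n)\<^sup>2)"
    proof (rule Limsup_bounded)
      show "\<forall>\<^sub>F m in sequentially. ennreal ((norm (X (r n) - X (r m)))\<^sup>2) \<le> ennreal (((1/2)^n)\<^sup>2)"
        using eventually_ge_at_top[of n]
      proof eventually_elim
        fix m
        assume "n \<le> m"
        then have "norm (X (r n) - X (r m)) < (1/2)^n"
          using mono by (intro r) (auto simp: strict_mono_less_eq)
        then show "ennreal ((norm (X (r n) - X (r m)))\<^sup>2) \<le> ennreal (((1/2)^n)\<^sup>2)"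
          by (intro ennreal_leI power_mono) auto
      qed
    qed
    finally show ?thesis .
  qed
  have "square_integrable (\<lambda>x. rep_L2 (X (r 0)) x - g x)"
  proof -
    have "integrable lborel (\<lambda>x. (rep_L2 (X (r 0)) x - g x)\<^sup>2)"
      using fatou[of 0] by (intro integrableI_nonneg) (auto simp: order_le_less_trans)
    then show ?thesis
      by (simp add: square_integrable_def)
  qed
  from square_integrable_diff[OF square_integrable_rep this, of "X (r 0)"]
  have g: "square_integrable g"
    by simp
  have "norm (X (r n) - abs_L2 g) \<le> (1/2)^n" for n
  proof -
    have "ennreal ((norm (X (r n) - abs_L2 g))\<^sup>2) =
        (\<integral>\<^sup>+x. ennreal ((rep_L2 (X (r n)) x - rep_L2 (abs_L2 g) x)\<^sup>2) \<partial>lborel)"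
      by (simp add: nn_integral_dist_L2)
    also have "\<dots> = (\<integral>\<^sup>+x. ennreal ((rep_L2 (X (r n)) x - g x)\<^sup>2) \<partial>lborel)"
      by (intro nn_integral_cong_AE eventually_mono[OF rep_abs_L2[OF g]]) simp
    also have "\<dots> \<le> ennreal (((1/2)^n)\<^sup>2)"
      by (rule fatou)
    finally have "(norm (X (r n) - abs_L2 g))\<^sup>2 \<le> ((1/2)^n)\<^sup>2"
      by (simp add: ennreal_le_iff)
    then show ?thesis
      by (rule power2_le_imp_le) simp
  qed
  moreover have "(\<lambda>n. (1/2::real)^n) \<longlonglongrightarrow> 0"
    by (rule LIMSEQ_power_zero) simp
  ultimately have "(\<lambda>n. X (r n) - abs_L2 g) \<longlonglongrightarrow> 0"
    by (rule Lim_null_comparison[OF always_eventually[OF allI]])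
  then have "(X \<circ> r) \<longlonglongrightarrow> abs_L2 g"
    by (simp add: LIM_zero_iff o_def)
  then show "convergent X"
    by (rule convergentI[OF Cauchy_converges_subseq[OF X mono]])
qed

section \<open>Orthonormal bases of Hilbert spaces\<close>

text \<open>
  The functional \<open>x \<mapsto> \<parallel>x\<parallel>\<^sup>2 / 2 - l x\<close> is bounded below, and by the parallelogram law every minimizing
  sequence in \<open>S\<close> is a Cauchy sequence. At the minimum the first variation vanishes, and this is the
  representation of \<open>l\<close>. Allowing a subspace \<open>S\<close> yields orthogonal projections as well, by
  taking \<open>l\<close> to be an inner product with a fixed vector.
\<close>

lemma Riesz_representation_on_subspace:
  fixes l :: "'a::{real_inner, complete_space} \<Rightarrow> real"
  assumes S: "subspace S" "closed S" and l: "bounded_linear l"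
  obtains p where "p \<in> S" "\<And>v. v \<in> S \<Longrightarrow> inner p v = l v"
proof -
  interpret l: bounded_linear l by fact
  define q where "q = (\<lambda>x. inner x x / 2 - l x)"
  obtain B where B: "\<And>x. norm (l x) \<le> norm x * B"
    using l.bounded by blast
  have "- (B\<^sup>2 / 2) \<le> q x" for x
  proof -
    have "0 \<le> (norm x - B)\<^sup>2 / 2"
      by simp
    then have "norm x * B \<le> (norm x)\<^sup>2 / 2 + B\<^sup>2 / 2"
      by (simp add: power2_diff field_simps)
    moreover have "l x \<le> norm x * B"
      using B[of x] by simp
    ultimately show ?thesis
      by (simp add: q_def power2_norm_eq_inner)
  qed
  then have bdd: "bdd_below (q ` S)"
    by (intro bdd_belowI2)
  define I where "I = (INF x\<in>S. q x)"
  have I_le: "I \<le> q x" if "x \<in> S" for x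
    unfolding I_def by (rule cINF_lower[OF bdd that])
  have "\<exists>x\<in>S. q x < I + 1 / real (Suc n)" for n
    using cINF_less_iff[OF _ bdd, of "I + 1 / real (Suc n)"] subspace_0[OF S(1)]
    by (auto simp: I_def)
  then obtain x where x: "\<And>n. x n \<in> S" "\<And>n. q (x n) < I + 1 / real (Suc n)"
    unfolding Bex_def by metis
  have cauchy_bound: "(norm (x n - x m))\<^sup>2 \<le> 4 * (1 / real (Suc n) + 1 / real (Suc m))" for n m
  proof -
    have "(1/2) *\<^sub>R (x n + x m) \<in> S"
      using x S by (intro subspace_scale subspace_add) auto
    note I_le[OF this]
    moreover have "q (x n) + q (x m) - 2 * q ((1/2) *\<^sub>R (x n + x m)) = (norm (x n - x m))\<^sup>2 / 4"
      by (simp add: q_def l.scaleR l.add power2_norm_eq_inner inner_add inner_diff inner_commute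
          field_simps)
    moreover have "4 * (a + b) \<ge> N" if "I \<le> c" "u + v - 2 * c = N / 4" "u < I + a" "v < I + b"
      for a b c u v N :: real
      using that by simp
    ultimately show ?thesis
      using x(2)[of n] x(2)[of m] by blast
  qed
  have "Cauchy x"
  proof (rule CauchyI)
    fix e :: real
    assume "0 < e"
    then obtain N where N: "8 / e\<^sup>2 < real N"
      using reals_Archimedean2 by blast
    have "norm (x m - x n) < e" if "m \<ge> N" "n \<ge> N" for m n
    proof -
      have "8 / e\<^sup>2 < real (Suc m)" "8 / e\<^sup>2 < real (Suc n)"
        using N that by auto
      then have "8 / real (Suc m) < e\<^sup>2" "8 / real (Suc n) < e\<^sup>2"
        using \<open>0 < e\<close> by (auto simp: field_simps)
      then have "(norm (x m - x n))\<^sup>2 < e\<^sup>2"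
        using cauchy_bound[of m n] by simp
      then show ?thesis
        using \<open>0 < e\<close> by (simp add: power2_less_imp_less)
    qed
    then show "\<exists>M. \<forall>m\<ge>M. \<forall>n\<ge>M. norm (x m - x n) < e"
      by blast
  qed
  then obtain p where p: "x \<longlonglongrightarrow> p"
    by (auto simp: Cauchy_convergent_iff convergent_def)
  have pS: "p \<in> S"
    using S(2) x(1) p by (rule closed_sequentially)
  have "(\<lambda>n. q (x n)) \<longlonglongrightarrow> q p"
    unfolding q_def by (intro tendsto_intros p l.tendsto) simp
  moreover have "(\<lambda>n. I + 1 / real (Suc n)) \<longlonglongrightarrow> I"
    using tendsto_add[OF tendsto_const LIMSEQ_Suc[OF lim_1_over_n]] by simp
  ultimately have qp: "q p \<le> I"
    using x(2) by (intro LIMSEQ_le[of "\<lambda>n. q (x n)"]) (auto intro: less_imp_le)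
  have "inner p v = l v" if v: "v \<in> S" for v
  proof (cases "v = 0")
    case False
    define c where "c = inner p v - l v"
    \<comment> \<open>The step length that minimizes the quadratic \<open>q (p + t v)\<close>.\<close>
    define t where "t = - c / inner v v"
    have "q p \<le> q (p + t *\<^sub>R v)"
      using qp I_le[of "p + t *\<^sub>R v"] v pS S by (simp add: subspace_add subspace_scale)
    also have "q (p + t *\<^sub>R v) = q p + t * c + t\<^sup>2 * inner v v / 2"
      by (simp add: q_def c_def l.scaleR l.add inner_add inner_commute power2_eq_square field_simps)
    also have "\<dots> = q p - c\<^sup>2 / (2 * inner v v)"
      using False by (simp add: t_def power2_eq_square field_simps)
    finally have "c\<^sup>2 / (2 * inner v v) \<le> 0"
      by simp
    moreover have "0 < inner v v"
      using False by simp
    ultimately have "c\<^sup>2 \<le> 0"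
      by (simp add: divide_le_0_iff)
    then show ?thesis
      by (simp add: c_def)
  qed (simp add: l.zero)
  with pS show thesis
    by (rule that)
qed

lemma Riesz_representation:
  fixes l :: "'a::{real_inner, complete_space} \<Rightarrow> real"
  assumes "bounded_linear l"
  obtains p where "\<And>v. inner p v = l v"
  by (rule Riesz_representation_on_subspace[OF subspace_UNIV closed_UNIV assms]) (auto intro: that)

lemma subspace_closure_span:
  fixes E :: "'a::real_normed_vector set"
  shows "subspace (closure (span E))"
proof (rule subspaceI)
  show "0 \<in> closure (span E)"
    using closure_subset span_zero by blast
next
  fix x y
  assume "x \<in> closure (span E)" "y \<in> closure (span E)"
  then obtain a b where "\<And>n. a n \<in> span E" "a \<longlonglongrightarrow> x" "\<And>n. b n \<in> span E" "b \<longlonglongrightarrow> y"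
    by (auto simp: closure_sequential)
  then show "x + y \<in> closure (span E)"
    unfolding closure_sequential
    by (intro exI[of _ "\<lambda>n. a n + b n"]) (auto intro: span_add tendsto_add)
next
  fix c x
  assume "x \<in> closure (span E)"
  then obtain a where "\<And>n. a n \<in> span E" "a \<longlonglongrightarrow> x"
    by (auto simp: closure_sequential)
  then show "c *\<^sub>R x \<in> closure (span E)"
    unfolding closure_sequential
    by (intro exI[of _ "\<lambda>n. c *\<^sub>R a n"]) (auto intro: span_scale tendsto_intros)
qed

text \<open>
  In a complete space a total orthonormal set is a basis: a vector differs from its projection onto
  the closed span by something orthogonal to the set.
\<close>

lemma orthonormal_basisI:
  fixes E :: "'a::{real_inner, complete_space} set"
  assumes "\<And>e. e \<in> E \<Longrightarrow> norm e = 1" "pairwise orthogonal E"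
    and total: "\<And>x. (\<And>e. e \<in> E \<Longrightarrow> inner x e = 0) \<Longrightarrow> x = 0"
  shows "orthonormal_basis E"
  unfolding orthonormal_basis_def
proof (intro conjI ballI)
  show "closure (span E) = UNIV"
  proof (intro UNIV_eq_I[symmetric])
    fix f
    obtain p where p: "p \<in> closure (span E)" "\<And>v. v \<in> closure (span E) \<Longrightarrow> inner p v = inner f v"
      by (rule Riesz_representation_on_subspace[OF subspace_closure_span[of E] closed_closure
            bounded_linear_inner_right[of f]]) blast
    have "inner (f - p) e = 0" if "e \<in> E" for e
      using p(2)[of e] that closure_subset span_base by (fastforce simp: inner_diff_left)
    then have "f - p = 0"
      by (rule total)
    with p(1) show "f \<in> closure (span E)"
      by simp
  qed
qed (use assms in auto)

text \<open>
  A maximal orthonormal set, given by Zorn's lemma, is total. The definition of the trace is a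
  statement about all orthonormal bases, so without this lemma it would determine no number.
\<close>

lemma orthonormal_basis_exists:
  "\<exists>E :: 'a::{real_inner, complete_space} set. orthonormal_basis E"
proof -
  define \<O> where "\<O> = {E :: 'a set. (\<forall>e\<in>E. norm e = 1) \<and> pairwise orthogonal E}"
  have "\<exists>E\<in>\<O>. \<forall>X\<in>\<O>. E \<subseteq> X \<longrightarrow> X = E"
  proof (rule subset_Zorn_nonempty)
    show "\<O> \<noteq> {}"
      by (auto simp: \<O>_def intro: exI[of _ "{}"])
    fix \<C>
    assume "\<C> \<noteq> {}" "subset.chain \<O> \<C>"
    then have C: "\<C> \<subseteq> \<O>" "\<And>X Y. X \<in> \<C> \<Longrightarrow> Y \<in> \<C> \<Longrightarrow> X \<subseteq> Y \<or> Y \<subseteq> X"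
      by (auto simp: subset_chain_def)
    have "pairwise orthogonal (\<Union>\<C>)"
    proof (rule pairwiseI)
      fix x y
      assume "x \<in> \<Union>\<C>" "y \<in> \<Union>\<C>" and xy: "x \<noteq> y"
      then obtain Z where "Z \<in> \<C>" "x \<in> Z" "y \<in> Z"
        using C(2) by blast
      with C(1) xy show "orthogonal x y"
        by (auto simp: \<O>_def pairwise_def)
    qed
    with C(1) show "\<Union>\<C> \<in> \<O>"
      by (auto simp: \<O>_def)
  qed
  then obtain E where E: "E \<in> \<O>" and max: "\<And>X. X \<in> \<O> \<Longrightarrow> E \<subseteq> X \<Longrightarrow> X = E"
    by blast
  have "orthonormal_basis E"
  proof (rule orthonormal_basisI)
    fix x
    assume x: "\<And>e. e \<in> E \<Longrightarrow> inner x e = 0"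
    show "x = 0"
    proof (rule ccontr)
      assume "x \<noteq> 0"
      define u where "u = x /\<^sub>R norm x"
      have u: "norm u = 1" "\<And>e. e \<in> E \<Longrightarrow> inner u e = 0"
        using \<open>x \<noteq> 0\<close> x by (simp_all add: u_def)
      then have "insert u E \<in> \<O>"
        using E by (auto simp: \<O>_def pairwise_insert orthogonal_def inner_commute)
      then have "u \<in> E"
        using max by blast
      then have "inner u u = 0"
        by (rule u)
      with u(1) show False
        by auto
    qed
  qed (use E in \<open>auto simp: \<O>_def\<close>)
  then show ?thesis ..
qed

lemma orthonormal_basis_inner:
  assumes "orthonormal_basis E" "e \<in> E" "e' \<in> E"
  shows "inner e e' = (if e = e' then 1 else 0)"
  using assms
  by (auto simp: orthonormal_basis_def pairwise_def orthogonal_def dot_square_norm)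

lemma orthonormal_expansion_error:
  assumes E: "orthonormal_basis E" and F: "finite F" "F \<subseteq> E"
  shows "(norm (f - (\<Sum>e\<in>F. inner f e *\<^sub>R e)))\<^sup>2 = (norm f)\<^sup>2 - (\<Sum>e\<in>F. (inner f e)\<^sup>2)"
proof -
  let ?p = "\<Sum>e\<in>F. inner f e *\<^sub>R e"
  have pe: "inner ?p e = inner f e" if "e \<in> F" for e
  proof -
    have "inner ?p e = (\<Sum>e'\<in>F. inner f e' * (if e' = e then 1 else 0))"
      unfolding inner_sum_left inner_scaleR_left
      using F(2) that by (intro sum.cong arg_cong2[where f = "(*)"] orthonormal_basis_inner[OF E]) auto
    also have "\<dots> = inner f e"
      using F(1) that by (simp add: if_distrib cong: if_cong)
    finally show ?thesis .
  qed
  have fp: "inner f ?p = (\<Sum>e\<in>F. (inner f e)\<^sup>2)"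
    by (simp add: inner_sum_right power2_eq_square)
  have pp: "inner ?p ?p = (\<Sum>e\<in>F. (inner f e)\<^sup>2)"
    unfolding inner_sum_right inner_scaleR_right by (simp add: pe power2_eq_square)
  show ?thesis
    unfolding power2_norm_eq_inner inner_diff_left inner_diff_right pp
    using fp by (simp add: inner_commute[of ?p f])
qed

text \<open>
  A finite partial expansion \<open>p F\<close> is exact on \<open>g \<in> span E\<close> once \<open>F\<close> contains the basis vectors that
  occur in \<open>g\<close>, and \<open>x - p F x\<close> is never longer than \<open>x\<close>. Hence an approximation of \<open>f\<close> by \<open>g\<close> bounds
  the error of the expansion of \<open>f\<close>.
\<close>

lemma Parseval:
  fixes f :: "'a::real_inner"
  assumes E: "orthonormal_basis E"
  shows "((\<lambda>e. (inner f e)\<^sup>2) has_sum (norm f)\<^sup>2) E"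
proof -
  define p where "p = (\<lambda>F x. \<Sum>e\<in>F. inner x e *\<^sub>R e :: 'a)"
  have Bessel: "(\<Sum>e\<in>F. (inner f e)\<^sup>2) \<le> (norm f)\<^sup>2" if "finite F" "F \<subseteq> E" for F and f :: 'a
    using orthonormal_expansion_error[OF E that, of f]
    by (metis diff_ge_0_iff_ge zero_le_power2)
  have contraction: "norm (x - p F x) \<le> norm x" if "finite F" "F \<subseteq> E" for F x
  proof (rule power2_le_imp_le)
    show "(norm (x - p F x))\<^sup>2 \<le> (norm x)\<^sup>2"
      unfolding p_def orthonormal_expansion_error[OF E that] by (simp add: sum_nonneg)
  qed simp
  have exact: "\<exists>F. finite F \<and> F \<subseteq> E \<and> (\<forall>F'. finite F' \<and> F \<subseteq> F' \<and> F' \<subseteq> E \<longrightarrow> p F' g = g)"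
    if "g \<in> span E" for g
    using that
  proof (induction rule: span_induct_alt)
    case base
    show ?case
      by (intro exI[of _ "{}"]) (simp add: p_def)
  next
    case (step c e g)
    from step(2) obtain F where F: "finite F" "F \<subseteq> E"
      and F_exact: "\<forall>F'. finite F' \<and> F \<subseteq> F' \<and> F' \<subseteq> E \<longrightarrow> p F' g = g"
      by (elim exE conjE)
    have "p F' (c *\<^sub>R e + g) = c *\<^sub>R e + g" if F': "finite F'" "insert e F \<subseteq> F'" "F' \<subseteq> E" for F'
    proof -
      have "p F' e = (\<Sum>e'\<in>F'. (if e' = e then e else 0))"
        unfolding p_def
      proof (rule sum.cong)
        fix e'
        assume "e' \<in> F'"
        with F' step(1) show "inner e e' *\<^sub>R e' = (if e' = e then e else 0)"
          using orthonormal_basis_inner[OF E, of e e'] by auto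
      qed simp
      also have "\<dots> = e"
        using F' by simp
      finally have "p F' e = e" .
      moreover have "p F' (c *\<^sub>R e + g) = c *\<^sub>R p F' e + p F' g"
        by (simp add: p_def inner_add_left scaleR_add_left sum.distrib scaleR_sum_right)
      ultimately show ?thesis
        using F_exact F' by simp
    qed
    then show ?case
      using F step(1) by (intro exI[of _ "insert e F"]) auto
  qed
  show ?thesis
    unfolding has_sum_def
  proof (rule tendstoI)
    fix \<epsilon> :: real
    assume "0 < \<epsilon>"
    define d where "d = sqrt \<epsilon> / 2"
    have d: "0 < d" "(2 * d)\<^sup>2 = \<epsilon>"
      using \<open>0 < \<epsilon>\<close> by (simp_all add: d_def)
    have "f \<in> closure (span E)"
      using E by (simp add: orthonormal_basis_def)
    then obtain g where g: "g \<in> span E" "dist g f < d"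
      using d(1) closure_approachable by blast
    from exact[OF g(1)] obtain F where F: "finite F" "F \<subseteq> E"
      and F_exact: "\<forall>F'. finite F' \<and> F \<subseteq> F' \<and> F' \<subseteq> E \<longrightarrow> p F' g = g"
      by (elim exE conjE)
    have "dist (\<Sum>e\<in>F'. (inner f e)\<^sup>2) ((norm f)\<^sup>2) < \<epsilon>" if F': "finite F'" "F \<subseteq> F'" "F' \<subseteq> E" for F'
    proof -
      have "f - p F' f = (f - g) - p F' (f - g)"
        using F_exact F' by (simp add: p_def inner_diff_left scaleR_diff_left sum_subtractf)
      then have "norm (f - p F' f) \<le> norm (f - g)"
        using contraction[OF F'(1,3), of "f - g"] by (rule ssubst)
      also have "\<dots> < 2 * d"
        using g(2) d(1) by (simp add: dist_norm norm_minus_commute)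
      finally have "(norm (f - p F' f))\<^sup>2 < (2 * d)\<^sup>2"
        by (intro power_strict_mono) auto
      then have "(norm f)\<^sup>2 - (\<Sum>e\<in>F'. (inner f e)\<^sup>2) < \<epsilon>"
        using orthonormal_expansion_error[OF E F'(1,3), of f] d(2) by (simp add: p_def)
      with Bessel[OF F'(1,3), of f] show ?thesis
        by (simp add: dist_real_def)
    qed
    then show "\<forall>\<^sub>F F in finite_subsets_at_top E. dist (\<Sum>e\<in>F. (inner f e)\<^sup>2) ((norm f)\<^sup>2) < \<epsilon>"
      unfolding eventually_finite_subsets_at_top using F by (intro exI[of _ F]) simp
  qed
qed

text \<open>
  Polarization. The terms and the limit may live in different spaces, so that this covers both the
  coefficients in Parseval's identity and the values of Hilbert-Schmidt operators on a basis.
\<close>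

lemma has_sum_inner_polarization:
  fixes u v :: "'i \<Rightarrow> 'a::real_inner" and a b :: "'b::real_inner"
  assumes "((\<lambda>i. (norm (u i + v i))\<^sup>2) has_sum (norm (a + b))\<^sup>2) I"
    and "((\<lambda>i. (norm (u i - v i))\<^sup>2) has_sum (norm (a - b))\<^sup>2) I"
  shows "((\<lambda>i. inner (u i) (v i)) has_sum inner a b) I"
proof -
  have polar: "inner x y = ((norm (x + y))\<^sup>2 - (norm (x - y))\<^sup>2) / 4" for x y :: "'c::real_inner"
    by (simp add: power2_norm_eq_inner inner_add inner_diff inner_commute)
  have minus: "((\<lambda>i. - ((norm (u i - v i))\<^sup>2)) has_sum - ((norm (a - b))\<^sup>2)) I"
    using assms(2) by (simp add: has_sum_uminus)
  show ?thesis
    using has_sum_cmult_left[OF has_sum_add[OF assms(1) minus], of "1/4"]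
    by (simp add: polar)
qed

lemma Parseval_inner:
  fixes f g :: "'a::real_inner"
  assumes E: "orthonormal_basis E"
  shows "((\<lambda>e. inner f e * inner g e) has_sum inner f g) E"
  using has_sum_inner_polarization[where u = "\<lambda>e. inner f e" and v = "\<lambda>e. inner g e" and a = f and b = g and I = E]
    Parseval[OF E, of "f + g"] Parseval[OF E, of "f - g"]
  by (simp add: inner_add_left inner_diff_left)

section \<open>Kernels as operators\<close>

lemma square_integrable_indicator_box:
  "square_integrable (indicator (box a b) :: 'a::euclidean_space \<Rightarrow> real)"
proof -
  have "(\<lambda>x. (indicator (box a b) x :: real)\<^sup>2) = indicator (box a b)"
    by (auto simp: indicator_def)
  then show ?thesis
    using emeasure_lborel_box_finite[of a b]
    by (simp add: square_integrable_def integrable_real_indicator)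
qed

text \<open>
  The positive and the negative part of \<open>f\<close> are densities of two measures that agree on boxes. The
  boxes generate the Borel sets, so that the measures and hence the densities agree. Boxes have finite
  measure under both since \<open>f\<close> is locally integrable.
\<close>

lemma L2_zero_if_box_integrals_zero:
  fixes f :: "'a::euclidean_space L2"
  assumes zero: "\<And>a b. (\<integral>x. rep_L2 f x * indicator (box a b) x \<partial>lborel) = 0"
  shows "f = 0"
proof -
  define p where "p = (\<lambda>x. max 0 (rep_L2 f x))"
  define m where "m = (\<lambda>x. max 0 (- rep_L2 f x))"
  have [measurable]: "p \<in> borel_measurable borel" "m \<in> borel_measurable borel"
    by (simp_all add: p_def m_def)
  have fi: "integrable lborel (\<lambda>x. rep_L2 f x * indicator (box a b) x)" for a b
    by (rule square_integrable_mult[OF square_integrable_rep square_integrable_indicator_box])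
  have pi: "integrable lborel (\<lambda>x. p x * indicator (box a b) x)"
    and mi: "integrable lborel (\<lambda>x. m x * indicator (box a b) x)" for a b
    by (rule Bochner_Integration.integrable_bound[OF fi[of a b]];
        auto simp: p_def m_def indicator_def)+
  have split: "p x * c = rep_L2 f x * c + m x * c" for x c
    by (auto simp: p_def m_def max_def algebra_simps)
  have on_box: "emeasure (density lborel (\<lambda>x. ennreal (h x))) (box a b) = ennreal (\<integral>x. h x * indicator (box a b) x \<partial>lborel)"
    if [measurable]: "h \<in> borel_measurable borel" and "\<And>x. 0 \<le> h x"
      and "integrable lborel (\<lambda>x. h x * indicator (box a b) x)" for h and a b :: 'a
  proof -
    have "emeasure (density lborel (\<lambda>x. ennreal (h x))) (box a b) =
        (\<integral>\<^sup>+x. ennreal (h x * indicator (box a b) x) \<partial>lborel)"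
      by (subst emeasure_density) (auto intro!: nn_integral_cong simp: indicator_def)
    then show ?thesis
      using that by (subst (asm) nn_integral_eq_integral) auto
  qed
  have eq: "(\<integral>x. p x * indicator (box a b) x \<partial>lborel) = (\<integral>x. m x * indicator (box a b) x \<partial>lborel)" for a b
    unfolding split using zero[of a b] by (simp add: Bochner_Integration.integral_add[OF fi mi])
  have "density lborel (\<lambda>x. ennreal (p x)) = density lborel (\<lambda>x. ennreal (m x))"
  proof (rule measure_eqI_generator_eq)
    let ?E = "range (\<lambda>(a, b). box a b) :: 'a set set"
    show "Int_stable ?E"
      by (auto simp: Int_stable_def box_Int_box)
    show "sets (density lborel (\<lambda>x. ennreal (p x))) = sigma_sets UNIV ?E"
         "sets (density lborel (\<lambda>x. ennreal (m x))) = sigma_sets UNIV ?E"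
      by (simp_all add: borel_eq_box)
    let ?A = "\<lambda>n::nat. box (- (real n *\<^sub>R One)) (real n *\<^sub>R One) :: 'a set"
    show "range ?A \<subseteq> ?E" "(\<Union>i. ?A i) = UNIV"
      unfolding UN_box_eq_UNIV by auto
    show "emeasure (density lborel (\<lambda>x. ennreal (p x))) (?A i) \<noteq> \<infinity>" for i
      using pi by (subst on_box) (auto simp: p_def)
    fix X
    assume "X \<in> ?E"
    then obtain a b where X: "X = box a b"
      by auto
    show "emeasure (density lborel (\<lambda>x. ennreal (p x))) X = emeasure (density lborel (\<lambda>x. ennreal (m x))) X"
      unfolding X using pi[of a b] mi[of a b] eq[of a b] by (simp add: on_box p_def m_def)
  qed auto
  then have "AE x in lborel. ennreal (p x) = ennreal (m x)"
    by (intro sigma_finite_measure.density_unique[OF lborel.sigma_finite_measure_axioms]) auto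
  then have f0: "AE x in lborel. rep_L2 f x = 0"
    by eventually_elim (auto simp: p_def m_def max_def split: if_splits)
  have "inner f f = 0"
    unfolding inner_L2_rep by (rule integral_eq_zero_AE) (use f0 in eventually_elim, simp)
  then show ?thesis
    by simp
qed

lemma borel_measurable_fst_real [measurable]: "(fst :: real \<times> real \<Rightarrow> real) \<in> borel_measurable borel"
  and borel_measurable_snd_real [measurable]: "(snd :: real \<times> real \<Rightarrow> real) \<in> borel_measurable borel"
  by (simp_all flip: borel_prod)

text \<open>
  The kernel of the rank-one operator \<open>\<theta> \<mapsto> \<langle>\<phi>, \<theta>\<rangle> \<psi>\<close>.
\<close>

definition tensor :: "real L2 \<Rightarrow> real L2 \<Rightarrow> hs" where
  "tensor \<psi> \<phi> = abs_L2 (\<lambda>(x, y). rep_L2 \<psi> x * rep_L2 \<phi> y)"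

lemma integrable_tensor:
  fixes f g :: "real \<Rightarrow> real"
  assumes "integrable lborel f" "integrable lborel g"
  shows "integrable lborel (\<lambda>z. f (fst z) * g (snd z))"
proof -
  have [measurable]: "f \<in> borel_measurable borel" "g \<in> borel_measurable borel"
    using borel_measurable_integrable[OF assms(1)] borel_measurable_integrable[OF assms(2)] by auto
  have "integrable (lborel \<Otimes>\<^sub>M lborel) (\<lambda>z. f (fst z) * g (snd z))"
    using assms by (intro lborel_pair.Fubini_integrable) (auto simp: abs_mult)
  then show ?thesis
    by (simp add: lborel_prod)
qed

lemma square_integrable_tensor:
  assumes "square_integrable f" "square_integrable g"
  shows "square_integrable (\<lambda>(x::real, y::real). f x * g y)"
proof -
  have [measurable]: "f \<in> borel_measurable borel" "g \<in> borel_measurable borel"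
    using assms by (auto simp: square_integrable_def)
  have "integrable lborel (\<lambda>z. (f (fst z))\<^sup>2 * (g (snd z))\<^sup>2)"
    using assms by (intro integrable_tensor) (auto simp: square_integrable_def)
  then show ?thesis
    by (simp add: square_integrable_def case_prod_beta' power_mult_distrib)
qed

lemma rep_tensor: "AE z in lborel. rep_L2 (tensor \<psi> \<phi>) z = rep_L2 \<psi> (fst z) * rep_L2 \<phi> (snd z)"
  using rep_abs_L2[OF square_integrable_tensor[OF square_integrable_rep[of \<psi>] square_integrable_rep[of \<phi>]]]
  by (simp add: tensor_def case_prod_beta')

lemma inner_tensor_right:
  "inner A (tensor \<psi> \<phi>) = (\<integral>z. rep_L2 A z * (rep_L2 \<psi> (fst z) * rep_L2 \<phi> (snd z)) \<partial>lborel)"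
  unfolding inner_L2_rep
  by (intro integral_cong_AE eventually_mono[OF rep_tensor[of \<psi> \<phi>]]) auto

lemma integrable_kernel_tensor:
  fixes A :: hs
  shows "integrable (lborel \<Otimes>\<^sub>M lborel) (\<lambda>z. rep_L2 A z * (rep_L2 \<psi> (fst z) * rep_L2 \<phi> (snd z)))"
  using square_integrable_mult[OF square_integrable_rep[of A]
      square_integrable_tensor[OF square_integrable_rep[of \<psi>] square_integrable_rep[of \<phi>]]]
  by (simp add: case_prod_beta' lborel_prod)

text \<open>
  The Cauchy-Schwarz inequality on almost every section of the kernel.
\<close>

lemma square_integrable_int_op:
  "square_integrable (\<lambda>x. \<integral>y. rep_L2 A (x, y) * rep_L2 \<phi> y \<partial>lborel)"
proof -
  let ?T = "\<lambda>x. \<integral>y. rep_L2 A (x, y) * rep_L2 \<phi> y \<partial>lborel"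
  have A2: "integrable (lborel \<Otimes>\<^sub>M lborel) (\<lambda>z. (rep_L2 A z)\<^sup>2)"
    using square_integrable_rep[of A] by (simp add: square_integrable_def lborel_prod)
  have "integrable lborel (\<lambda>x. (?T x)\<^sup>2)"
  proof (rule Bochner_Integration.integrable_bound)
    show "integrable lborel (\<lambda>x. (\<integral>y. (rep_L2 A (x, y))\<^sup>2 \<partial>lborel) * (norm \<phi>)\<^sup>2)"
      by (intro integrable_mult_left lborel_pair.integrable_fst'[OF A2])
    show "AE x in lborel. norm ((?T x)\<^sup>2) \<le> norm ((\<integral>y. (rep_L2 A (x, y))\<^sup>2 \<partial>lborel) * (norm \<phi>)\<^sup>2)"
      using lborel_pair.AE_integrable_fst'[OF A2]
    proof eventually_elim
      fix x
      assume "integrable lborel (\<lambda>y. (rep_L2 A (x, y))\<^sup>2)"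
      then have sq: "square_integrable (\<lambda>y. rep_L2 A (x, y))"
        by (simp add: square_integrable_def)
      have "(?T x)\<^sup>2 = (inner (abs_L2 (\<lambda>y. rep_L2 A (x, y))) \<phi>)\<^sup>2"
        using inner_L2_abs[OF sq square_integrable_rep[of \<phi>]] by (simp add: abs_rep_L2)
      also have "\<dots> \<le> (norm (abs_L2 (\<lambda>y. rep_L2 A (x, y))))\<^sup>2 * (norm \<phi>)\<^sup>2"
        unfolding power2_norm_eq_inner by (rule Cauchy_Schwarz_ineq)
      also have "(norm (abs_L2 (\<lambda>y. rep_L2 A (x, y))))\<^sup>2 = (\<integral>y. (rep_L2 A (x, y))\<^sup>2 \<partial>lborel)"
        unfolding power2_norm_eq_inner inner_L2_abs[OF sq sq] by (simp add: power2_eq_square)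
      finally show "norm ((?T x)\<^sup>2) \<le> norm ((\<integral>y. (rep_L2 A (x, y))\<^sup>2 \<partial>lborel) * (norm \<phi>)\<^sup>2)"
        by simp
    qed
  qed measurable
  then show ?thesis
    by (simp add: square_integrable_def)
qed

text \<open>
  Fubini's theorem. Adjoints, compositions and traces are handled through this identity instead of
  through iterated integrals.
\<close>

lemma inner_int_op: "inner (int_op A \<phi>) \<psi> = inner A (tensor \<psi> \<phi>)"
proof -
  have "inner (int_op A \<phi>) \<psi> = (\<integral>x. (\<integral>y. rep_L2 A (x, y) * rep_L2 \<phi> y \<partial>lborel) * rep_L2 \<psi> x \<partial>lborel)"
    using inner_L2_abs[OF square_integrable_int_op[of A \<phi>] square_integrable_rep[of \<psi>]]
    by (simp add: int_op_def abs_rep_L2)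
  also have "\<dots> = (\<integral>x. (\<integral>y. rep_L2 A (x, y) * (rep_L2 \<psi> x * rep_L2 \<phi> y) \<partial>lborel) \<partial>lborel)"
    by (simp add: mult.commute mult.left_commute flip: integral_mult_right_zero)
  also have "\<dots> = inner A (tensor \<psi> \<phi>)"
    using lborel_pair.integral_fst'[OF integrable_kernel_tensor[of A \<psi> \<phi>]]
    by (simp add: inner_tensor_right lborel_prod)
  finally show ?thesis .
qed

lemma inner_tensor_abs:
  fixes f g :: "real \<Rightarrow> real"
  assumes f: "square_integrable f" and g: "square_integrable g"
  shows "inner A (tensor (abs_L2 f) (abs_L2 g)) = (\<integral>z. rep_L2 A z * (f (fst z) * g (snd z)) \<partial>lborel)"
  unfolding inner_tensor_right
proof (rule integral_cong_AE)
  have [measurable]: "f \<in> borel_measurable borel" "g \<in> borel_measurable borel"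
    using assms by (auto simp: square_integrable_def)
  show "AE z in lborel. rep_L2 A z * (rep_L2 (abs_L2 f) (fst z) * rep_L2 (abs_L2 g) (snd z)) =
      rep_L2 A z * (f (fst z) * g (snd z))"
    unfolding lborel_prod[symmetric]
  proof (rule lborel_pair.AE_pair_measure)
    show "{z \<in> space (lborel \<Otimes>\<^sub>M lborel). rep_L2 A z * (rep_L2 (abs_L2 f) (fst z) * rep_L2 (abs_L2 g) (snd z)) =
        rep_L2 A z * (f (fst z) * g (snd z))} \<in> sets (lborel \<Otimes>\<^sub>M lborel)"
      unfolding lborel_prod by measurable
    show "AE x in lborel. AE y in lborel. rep_L2 A (x, y) *
        (rep_L2 (abs_L2 f) (fst (x, y)) * rep_L2 (abs_L2 g) (snd (x, y))) =
        rep_L2 A (x, y) * (f (fst (x, y)) * g (snd (x, y)))"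
      using rep_abs_L2[OF f] 
    proof eventually_elim
      fix x
      assume x: "rep_L2 (abs_L2 f) x = f x"
      show "AE y in lborel. rep_L2 A (x, y) *
          (rep_L2 (abs_L2 f) (fst (x, y)) * rep_L2 (abs_L2 g) (snd (x, y))) =
          rep_L2 A (x, y) * (f (fst (x, y)) * g (snd (x, y)))"
        using rep_abs_L2[OF g] by eventually_elim (simp add: x)
    qed
  qed
  show "(\<lambda>z. rep_L2 A z * (rep_L2 (abs_L2 f) (fst z) * rep_L2 (abs_L2 g) (snd z))) \<in> borel_measurable lborel"
    "(\<lambda>z. rep_L2 A z * (f (fst z) * g (snd z))) \<in> borel_measurable lborel"
    by simp_all
qed

text \<open>
  The indicator of a box in the plane is a product of indicators of intervals, so a kernel orthogonal
  to all rank-one kernels has vanishing integrals over boxes.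
\<close>

lemma hs_eqI:
  assumes "\<And>\<psi> \<phi>. inner A (tensor \<psi> \<phi>) = inner B (tensor \<psi> \<phi>)"
  shows "A = B"
proof -
  have "A - B = 0"
  proof (rule L2_zero_if_box_integrals_zero)
    fix a b :: "real \<times> real"
    let ?i = "\<lambda>I. indicator I :: real \<Rightarrow> real"
    let ?I = "box (fst a) (fst b)" and ?J = "box (snd a) (snd b)"
    have "(\<integral>z. rep_L2 (A - B) z * indicator (box a b) z \<partial>lborel) =
        (\<integral>z. rep_L2 (A - B) z * (?i ?I (fst z) * ?i ?J (snd z)) \<partial>lborel)"
      by (auto simp: box_prod[of a b] indicator_def intro!: Bochner_Integration.integral_cong)
    also have "\<dots> = inner (A - B) (tensor (abs_L2 (?i ?I)) (abs_L2 (?i ?J)))"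
      by (rule inner_tensor_abs[symmetric]; rule square_integrable_indicator_box)
    also have "\<dots> = 0"
      using assms by (simp add: inner_diff_left)
    finally show "(\<integral>z. rep_L2 (A - B) z * indicator (box a b) z \<partial>lborel) = 0" .
  qed
  then show ?thesis
    by simp
qed

text \<open>
  The transposed kernel, that is, the kernel of the adjoint operator.
\<close>

definition flip :: "hs \<Rightarrow> hs" where
  "flip A = abs_L2 (\<lambda>z. rep_L2 A (snd z, fst z))"

lemma integral_swap:
  fixes f :: "real \<times> real \<Rightarrow> real"
  assumes [measurable]: "f \<in> borel_measurable borel"
  shows "(\<integral>z. f (snd z, fst z) \<partial>lborel) = (\<integral>z. f z \<partial>lborel)"
  using lborel_pair.integral_product_swap[of f]
  by (simp add: lborel_prod case_prod_beta' borel_prod)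

lemma square_integrable_flip: "square_integrable (\<lambda>z. rep_L2 A (snd z, fst z))" for A :: hs
proof -
  have "integrable (lborel \<Otimes>\<^sub>M lborel) (\<lambda>z. (rep_L2 A z)\<^sup>2)"
    using square_integrable_rep[of A] by (simp add: square_integrable_def lborel_prod)
  from lborel_pair.integrable_product_swap[OF this]
  have "integrable lborel (\<lambda>z. (rep_L2 A (snd z, fst z))\<^sup>2)"
    by (simp add: lborel_prod case_prod_beta')
  then show ?thesis
    by (simp add: square_integrable_def)
qed

lemma rep_flip: "AE z in lborel. rep_L2 (flip A) z = rep_L2 A (snd z, fst z)"
  unfolding flip_def by (rule rep_abs_L2[OF square_integrable_flip])

lemma inner_flip_flip: "inner (flip A) (flip B) = inner A B"
  unfolding flip_def inner_L2_abs[OF square_integrable_flip square_integrable_flip]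
  by (subst integral_swap[of "\<lambda>z. rep_L2 A z * rep_L2 B z"]) (simp_all add: inner_L2_rep)

lemma inner_flip_rep: "inner A (flip B) = (\<integral>z. rep_L2 A z * rep_L2 B (snd z, fst z) \<partial>lborel)"
  using inner_L2_abs[OF square_integrable_rep square_integrable_flip, of A B]
  by (simp add: abs_rep_L2 flip_def)

lemma pairing_eq_inner: "pairing A B = inner A (flip B)"
  unfolding pairing_def inner_flip_rep by (simp add: case_prod_beta')

lemma inner_flip_tensor: "inner (flip A) (tensor \<psi> \<phi>) = inner A (tensor \<phi> \<psi>)"
proof -
  have "inner (flip A) (tensor \<psi> \<phi>) =
      (\<integral>z. rep_L2 A (snd z, fst z) * (rep_L2 \<psi> (fst z) * rep_L2 \<phi> (snd z)) \<partial>lborel)"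
    unfolding inner_tensor_right
    by (intro integral_cong_AE eventually_mono[OF rep_flip[of A]]) auto
  also have "\<dots> = (\<integral>z. rep_L2 A z * (rep_L2 \<phi> (fst z) * rep_L2 \<psi> (snd z)) \<partial>lborel)"
    by (subst integral_swap[symmetric]) (simp_all add: mult.commute)
  finally show ?thesis
    by (simp add: inner_tensor_right)
qed

lemma flip_flip [simp]: "flip (flip A) = A"
  by (rule hs_eqI) (simp add: inner_flip_tensor)

lemma inner_flip_left: "inner (flip A) B = inner A (flip B)"
  using inner_flip_flip[of A "flip B"] by simp

lemma flip_linear: "linear flip"
  by (rule linearI; rule hs_eqI) (simp_all add: inner_flip_tensor inner_add_left)

lemma norm_flip [simp]: "norm (flip A) = norm A"
  by (simp add: norm_eq_sqrt_inner inner_flip_flip)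

section \<open>Composition, trace and powers of Hilbert-Schmidt operators\<close>

lemma inner_tensor_tensor: "inner (tensor a b) (tensor c d) = inner a c * inner b d"
proof -
  have "inner (tensor a b) (tensor c d) =
      (\<integral>z. (rep_L2 a (fst z) * rep_L2 c (fst z)) * (rep_L2 b (snd z) * rep_L2 d (snd z)) \<partial>lborel)"
    unfolding inner_tensor_right
    by (intro integral_cong_AE eventually_mono[OF rep_tensor[of a b]]) auto
  also have "\<dots> = (\<integral>x. (\<integral>y. (rep_L2 a x * rep_L2 c x) * (rep_L2 b y * rep_L2 d y) \<partial>lborel) \<partial>lborel)"
    using lborel_pair.integral_fst'[of "\<lambda>z. (rep_L2 a (fst z) * rep_L2 c (fst z)) * (rep_L2 b (snd z) * rep_L2 d (snd z))"]
      integrable_tensor[OF integrable_rep_mult[of a c] integrable_rep_mult[of b d]]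
    by (simp add: lborel_prod)
  also have "\<dots> = inner a c * inner b d"
    by (simp add: inner_L2_rep)
  finally show ?thesis .
qed

lemma int_op_tensor: "int_op (tensor a b) \<phi> = inner b \<phi> *\<^sub>R a"
  by (rule vector_eq_rdot[THEN iffD1]) (simp add: inner_int_op inner_tensor_tensor)

lemma norm_tensor: "norm (tensor a b) = norm a * norm b"
  by (simp add: norm_eq_sqrt_inner inner_tensor_tensor real_sqrt_mult)

lemma int_op_adjoint: "inner (int_op A \<phi>) \<psi> = inner \<phi> (int_op (flip A) \<psi>)"
  by (simp add: inner_int_op inner_flip_tensor inner_commute[of \<phi>])

lemma int_op_add_kernel: "int_op (A + B) \<phi> = int_op A \<phi> + int_op B \<phi>"
  and int_op_diff_kernel: "int_op (A - B) \<phi> = int_op A \<phi> - int_op B \<phi>"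
  and int_op_minus_kernel: "int_op (- A) \<phi> = - int_op A \<phi>"
  and int_op_scaleR_kernel: "int_op (c *\<^sub>R A) \<phi> = c *\<^sub>R int_op A \<phi>"
  by (rule vector_eq_rdot[THEN iffD1];
      simp add: inner_int_op inner_add_left inner_diff_left)+

lemma int_op_add: "int_op A (\<phi> + \<psi>) = int_op A \<phi> + int_op A \<psi>"
  and int_op_scaleR: "int_op A (c *\<^sub>R \<phi>) = c *\<^sub>R int_op A \<phi>"
  by (rule vector_eq_rdot[THEN iffD1]; simp add: int_op_adjoint inner_add_left)+

lemma int_op_inject: "int_op A = int_op B \<longleftrightarrow> A = B"
proof
  assume "int_op A = int_op B"
  then show "A = B"
    by (intro hs_eqI) (metis inner_int_op)
qed simp

lemma kernel_int_op [simp]: "kernel (int_op A) = A"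
  unfolding kernel_def by (simp add: int_op_inject)

lemma norm_int_op_le: "norm (int_op A \<phi>) \<le> norm A * norm \<phi>"
proof -
  have "norm (int_op A \<phi>) * norm (int_op A \<phi>) = inner A (tensor (int_op A \<phi>) \<phi>)"
    by (simp add: dot_square_norm power2_eq_square flip: inner_int_op)
  also have "\<dots> \<le> norm A * norm (tensor (int_op A \<phi>) \<phi>)"
    by (rule norm_cauchy_schwarz)
  also have "\<dots> = (norm A * norm \<phi>) * norm (int_op A \<phi>)"
    by (simp add: norm_tensor)
  finally have "norm (int_op A \<phi>) * norm (int_op A \<phi>) \<le> (norm A * norm \<phi>) * norm (int_op A \<phi>)" .
  then show ?thesis
    by (cases "norm (int_op A \<phi>) = 0") (auto simp: mult_le_cancel_right)
qed

lemma orthonormal_basis_eqI: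
  fixes x y :: "'a::real_inner"
  assumes "orthonormal_basis E" "\<And>e. e \<in> E \<Longrightarrow> inner x e = inner y e"
  shows "x = y"
proof -
  have "((\<lambda>e. (inner (x - y) e)\<^sup>2) has_sum 0) E"
    using assms(2) by (intro has_sum_0) (simp add: inner_diff_left)
  then have "(norm (x - y))\<^sup>2 = 0"
    using has_sum_unique[OF Parseval[OF assms(1)]] by blast
  then show ?thesis
    by simp
qed

text \<open>
  For totality: if \<open>X\<close> is orthogonal to all these kernels, then \<open>X e\<close> has vanishing coefficients for
  every basis vector \<open>e\<close>, and so does the adjoint of \<open>X\<close> applied to any vector.
\<close>

lemma orthonormal_basis_tensor:
  assumes E: "orthonormal_basis E"
  shows "orthonormal_basis ((\<lambda>(a, b). tensor a b) ` (E \<times> E))"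
proof (rule orthonormal_basisI)
  show "norm u = 1" if "u \<in> (\<lambda>(a, b). tensor a b) ` (E \<times> E)" for u
    using that E by (auto simp: orthonormal_basis_def norm_tensor)
  show "pairwise orthogonal ((\<lambda>(a, b). tensor a b) ` (E \<times> E))"
  proof (rule pairwiseI)
    fix u v
    assume uv: "u \<in> (\<lambda>(a, b). tensor a b) ` (E \<times> E)" "v \<in> (\<lambda>(a, b). tensor a b) ` (E \<times> E)" "u \<noteq> v"
    then obtain a b c d where abcd: "u = tensor a b" "v = tensor c d" "a \<in> E" "b \<in> E" "c \<in> E" "d \<in> E"
      by auto
    with uv(3) have "a \<noteq> c \<or> b \<noteq> d"
      by auto
    with abcd show "orthogonal u v"
      by (auto simp: orthogonal_def inner_tensor_tensor orthonormal_basis_inner[OF E])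
  qed
next
  fix X
  assume X: "inner X u = 0" if "u \<in> (\<lambda>(a, b). tensor a b) ` (E \<times> E)" for u
  have Xe: "int_op X e = 0" if "e \<in> E" for e
    by (rule orthonormal_basis_eqI[OF E]) (use X that in \<open>auto simp: inner_int_op\<close>)
  have "int_op (flip X) \<psi> = 0" for \<psi>
    by (rule orthonormal_basis_eqI[OF E]) (simp add: int_op_adjoint Xe)
  then have "inner X (tensor \<psi> \<phi>) = 0" for \<psi> \<phi>
    by (simp add: int_op_adjoint flip: inner_int_op)
  then show "X = 0"
    by (intro hs_eqI) simp
qed

text \<open>
  The square of the Hilbert-Schmidt norm is the sum of the squared matrix entries of \<open>A\<close> by Parseval's
  identity in \<open>L\<^sup>2(\<real>\<^sup>2)\<close>; summing over rows first is Parseval's identity for each \<open>A e\<close>.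
\<close>

lemma has_sum_norm_int_op:
  assumes E: "orthonormal_basis E"
  shows "((\<lambda>e. (norm (int_op A e))\<^sup>2) has_sum (norm A)\<^sup>2) E"
proof (rule has_sum_SigmaD)
  have "inj_on (\<lambda>(a, b). tensor b a) (E \<times> E)"
  proof (rule inj_onI; clarify)
    fix a b c d
    assume *: "tensor b a = tensor d c" "a \<in> E" "b \<in> E" "c \<in> E" "d \<in> E"
    have "inner (tensor b a) (tensor b a) = 1"
      using *(2,3) by (simp add: inner_tensor_tensor orthonormal_basis_inner[OF E])
    then have "inner (tensor b a) (tensor d c) = 1"
      using *(1) by simp
    then have "inner b d * inner a c = 1"
      by (simp only: inner_tensor_tensor)
    then show "a = c \<and> b = d"
      using orthonormal_basis_inner[OF E *(3,5)] orthonormal_basis_inner[OF E *(2,4)]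
      by (simp split: if_splits)
  qed
  moreover have "(\<lambda>(a, b). tensor b a) ` (E \<times> E) = (\<lambda>(a, b). tensor a b) ` (E \<times> E)"
    by auto
  ultimately show "((\<lambda>(e, e'). (inner (int_op A e) e')\<^sup>2) has_sum (norm A)\<^sup>2) (E \<times> E)"
    using Parseval[OF orthonormal_basis_tensor[OF E], of A]
      has_sum_reindex[of "\<lambda>(a, b). tensor b a" "E \<times> E" "\<lambda>u. (inner A u)\<^sup>2" "(norm A)\<^sup>2"]
    by (simp add: inner_int_op case_prod_unfold o_def)
  show "((\<lambda>e'. (\<lambda>(e, e'). (inner (int_op A e) e')\<^sup>2) (e, e')) has_sum (norm (int_op A e))\<^sup>2) E" for e
    using Parseval[OF E] by simp
qed

lemma has_sum_inner_int_op:
  assumes E: "orthonormal_basis E"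
  shows "((\<lambda>e. inner (int_op A e) (int_op B e)) has_sum inner A B) E"
proof (rule has_sum_inner_polarization)
  show "((\<lambda>e. (norm (int_op A e + int_op B e))\<^sup>2) has_sum (norm (A + B))\<^sup>2) E"
    using has_sum_norm_int_op[OF E, of "A + B"] by (simp add: int_op_add_kernel)
  show "((\<lambda>e. (norm (int_op A e - int_op B e))\<^sup>2) has_sum (norm (A - B))\<^sup>2) E"
    using has_sum_norm_int_op[OF E, of "A - B"] by (simp add: int_op_diff_kernel)
qed

lemma pairing_commute: "pairing A B = pairing B A"
  unfolding pairing_eq_inner by (subst inner_commute) (rule inner_flip_left)

text \<open>
  Since \<open>\<langle>A B e, e\<rangle> = \<langle>B e, A\<^sup>* e\<rangle>\<close>, the sum is the inner product of the kernels of \<open>B\<close> and \<open>A\<^sup>*\<close>.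
\<close>

lemma has_sum_pairing:
  assumes "orthonormal_basis E"
  shows "((\<lambda>e. inner (int_op A (int_op B e)) e) has_sum pairing A B) E"
  using has_sum_inner_int_op[OF assms, of B "flip A"]
  by (simp add: int_op_adjoint[of A] pairing_commute[of A B] flip: pairing_eq_inner)

lemma trace_int_op_comp: "trace (int_op A \<circ> int_op B) = pairing A B"
proof -
  obtain E :: "real L2 set" where E: "orthonormal_basis E"
    using orthonormal_basis_exists by blast
  show ?thesis
    unfolding trace_def
  proof (rule the_equality)
    show "\<forall>E. orthonormal_basis E \<longrightarrow> ((\<lambda>e. inner ((int_op A \<circ> int_op B) e) e) has_sum pairing A B) E"
      using has_sum_pairing by simp
    show "s = pairing A B"
      if "\<forall>E. orthonormal_basis E \<longrightarrow> ((\<lambda>e. inner ((int_op A \<circ> int_op B) e) e) has_sum s) E" for s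
      using that E has_sum_pairing[OF E, of A B] has_sum_unique by fastforce
  qed
qed

text \<open>
  The kernel of a Hilbert-Schmidt operator \<open>T\<close> is found by duality: \<open>X \<mapsto> tr (X\<^sup>* T)\<close> is a bounded
  functional on kernels, and its Riesz representative has the same matrix entries as \<open>T\<close>.
\<close>

lemma operator_has_kernel:
  assumes E: "orthonormal_basis E"
    and adj: "\<And>\<phi> \<psi>. inner (T \<phi>) \<psi> = inner (T' \<psi>) \<phi>"
    and T: "(\<lambda>e. (norm (T e))\<^sup>2) summable_on E"
  obtains C where "int_op C = T"
proof -
  define l where "l = (\<lambda>X. infsum (\<lambda>e. inner (T e) (int_op X e)) E)"
  have dom: "(\<lambda>e. (norm (T e))\<^sup>2 + (norm (int_op X e))\<^sup>2) summable_on E" for X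
    by (intro summable_on_add T has_sum_imp_summable[OF has_sum_norm_int_op[OF E]])
  have le: "\<bar>inner a b\<bar> \<le> (norm a)\<^sup>2 + (norm b)\<^sup>2" for a b :: "real L2"
  proof -
    have "\<bar>inner a b\<bar> \<le> norm a * norm b"
      by (rule Cauchy_Schwarz_ineq2)
    also have "\<dots> \<le> 2 * norm a * norm b"
      by simp
    also have "\<dots> \<le> (norm a)\<^sup>2 + (norm b)\<^sup>2"
      by (rule sum_squares_bound)
    finally show ?thesis .
  qed
  have abs_summable: "(\<lambda>e. norm (inner (T e) (int_op X e))) summable_on E" for X
    by (rule summable_on_comparison_test[OF dom[of X]]) (auto intro: le)
  then have l_summable: "(\<lambda>e. inner (T e) (int_op X e)) summable_on E" for X
    by (rule abs_summable_summable)
  have l_le: "\<bar>l X\<bar> \<le> infsum (\<lambda>e. (norm (T e))\<^sup>2) E + (norm X)\<^sup>2" for X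
  proof -
    have "\<bar>l X\<bar> \<le> infsum (\<lambda>e. norm (inner (T e) (int_op X e))) E"
      unfolding l_def using norm_infsum_bound[OF abs_summable[of X]] by simp
    also have "\<dots> \<le> infsum (\<lambda>e. (norm (T e))\<^sup>2 + (norm (int_op X e))\<^sup>2) E"
      by (rule infsum_mono[OF abs_summable dom]) (auto intro: le)
    also have "\<dots> = infsum (\<lambda>e. (norm (T e))\<^sup>2) E + (norm X)\<^sup>2"
      using infsum_add[OF T has_sum_imp_summable[OF has_sum_norm_int_op[OF E, of X]]]
        infsumI[OF has_sum_norm_int_op[OF E, of X]] by simp
    finally show ?thesis .
  qed
  have l_add: "l (X + Y) = l X + l Y" for X Y
    unfolding l_def
    by (simp add: int_op_add_kernel inner_add_right infsum_add[OF l_summable l_summable])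
  have l_scale: "l (c *\<^sub>R X) = c *\<^sub>R l X" for c X
    by (simp add: l_def int_op_scaleR_kernel infsum_cmult_right')
  have "bounded_linear l"
  proof (rule bounded_linear_intro[OF l_add l_scale])
    fix X
    show "norm (l X) \<le> norm X * (infsum (\<lambda>e. (norm (T e))\<^sup>2) E + 1)"
    proof (cases "X = 0")
      case True
      then show ?thesis
        using l_scale[of 0 0] by simp
    next
      case False
      have "l X = norm X * l (X /\<^sub>R norm X)"
        using False by (simp add: l_scale)
      then show ?thesis
        using l_le[of "X /\<^sub>R norm X"] False by (simp add: abs_mult mult_left_mono)
    qed
  qed
  then obtain C where C: "\<And>X. inner C X = l X"
    by (rule Riesz_representation) (rule that)
  have "int_op C \<phi> = T \<phi>" for \<phi>
  proof (rule vector_eq_rdot[THEN iffD1], rule allI)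
    fix \<psi>
    have "inner (int_op C \<phi>) \<psi> = infsum (\<lambda>e. inner \<phi> e * inner (T' \<psi>) e) E"
      by (simp add: inner_int_op C l_def int_op_tensor flip: adj)
    also have "\<dots> = inner (T \<phi>) \<psi>"
      unfolding infsumI[OF Parseval_inner[OF E, of \<phi> "T' \<psi>"]] adj by (rule inner_commute)
    finally show "inner (int_op C \<phi>) \<psi> = inner (T \<phi>) \<psi>" .
  qed
  then have "int_op C = T"
    by (rule ext)
  then show thesis
    by (rule that)
qed

lemma norm_int_op_comp_le:
  "(norm (int_op A (int_op B e)))\<^sup>2 \<le> (norm A)\<^sup>2 * (norm (int_op B e))\<^sup>2"
  using power_mono[OF norm_int_op_le[of A "int_op B e"], of 2] by (simp add: power_mult_distrib)

lemma int_op_hs_comp: "int_op (hs_comp A B) = int_op A \<circ> int_op B"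
proof -
  obtain E :: "real L2 set" where E: "orthonormal_basis E"
    using orthonormal_basis_exists by blast
  have dom: "(\<lambda>e. (norm A)\<^sup>2 * (norm (int_op B e))\<^sup>2) summable_on E"
    by (rule has_sum_imp_summable[OF has_sum_cmult_right[OF has_sum_norm_int_op[OF E]]])
  have summable: "(\<lambda>e. (norm ((int_op A \<circ> int_op B) e))\<^sup>2) summable_on E"
    by (rule summable_on_comparison_test[OF dom]) (auto simp: norm_int_op_comp_le)
  have adj: "inner ((int_op A \<circ> int_op B) \<phi>) \<psi> = inner ((int_op (flip B) \<circ> int_op (flip A)) \<psi>) \<phi>" for \<phi> \<psi>
    by (simp add: int_op_adjoint inner_commute[of \<phi>])
  obtain C where "int_op C = int_op A \<circ> int_op B"
    by (rule operator_has_kernel[OF E adj summable]) (rule that)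
  then show ?thesis
    unfolding hs_comp_def by (metis kernel_int_op)
qed

lemma norm_hs_comp_le: "norm (hs_comp A B) \<le> norm A * norm B"
proof -
  obtain E :: "real L2 set" where E: "orthonormal_basis E"
    using orthonormal_basis_exists by blast
  have "(norm (hs_comp A B))\<^sup>2 \<le> (norm A)\<^sup>2 * (norm B)\<^sup>2"
    by (rule has_sum_mono[OF has_sum_norm_int_op[OF E] has_sum_cmult_right[OF has_sum_norm_int_op[OF E]]])
      (simp add: int_op_hs_comp norm_int_op_comp_le)
  then have "(norm (hs_comp A B))\<^sup>2 \<le> (norm A * norm B)\<^sup>2"
    by (simp add: power_mult_distrib)
  then show ?thesis
    by (rule power2_le_imp_le) simp
qed

interpretation hs_comp: bounded_bilinear hs_comp
proof
  show "hs_comp (A + A') B = hs_comp A B + hs_comp A' B" for A A' B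
    by (rule int_op_inject[THEN iffD1]) (simp add: fun_eq_iff int_op_hs_comp int_op_add_kernel)
  show "hs_comp A (B + B') = hs_comp A B + hs_comp A B'" for A B B'
    by (rule int_op_inject[THEN iffD1]) (simp add: fun_eq_iff int_op_hs_comp int_op_add_kernel int_op_add)
  show "hs_comp (c *\<^sub>R A) B = c *\<^sub>R hs_comp A B" for c A B
    by (rule int_op_inject[THEN iffD1]) (simp add: fun_eq_iff int_op_hs_comp int_op_scaleR_kernel)
  show "hs_comp A (c *\<^sub>R B) = c *\<^sub>R hs_comp A B" for c A B
    by (rule int_op_inject[THEN iffD1]) (simp add: fun_eq_iff int_op_hs_comp int_op_scaleR_kernel int_op_scaleR)
  show "\<exists>K. \<forall>A B. norm (hs_comp A B) \<le> norm A * norm B * K"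
    by (rule exI[of _ 1]) (simp add: norm_hs_comp_le)
qed

lemma abs_pairing_le: "\<bar>pairing A B\<bar> \<le> norm A * norm B"
  unfolding pairing_eq_inner using Cauchy_Schwarz_ineq2[of A "flip B"] by simp

interpretation pairing: bounded_bilinear pairing
proof
  note flip_simps = linear_add[OF flip_linear] linear_scale[OF flip_linear]
  show "pairing (A + A') B = pairing A B + pairing A' B" for A A' B
    by (simp add: pairing_eq_inner inner_add_left)
  show "pairing A (B + B') = pairing A B + pairing A B'" for A B B'
    by (simp add: pairing_eq_inner flip_simps inner_add_right)
  show "pairing (c *\<^sub>R A) B = c *\<^sub>R pairing A B" for c A B
    by (simp add: pairing_eq_inner)
  show "pairing A (c *\<^sub>R B) = c *\<^sub>R pairing A B" for c A B
    by (simp add: pairing_eq_inner flip_simps)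
  show "\<exists>K. \<forall>A B. norm (pairing A B) \<le> norm A * norm B * K"
    by (rule exI[of _ 1]) (simp add: abs_pairing_le)
qed

lemma pairing_nondegenerate:
  assumes "\<And>X. pairing A X = pairing B X"
  shows "A = B"
proof -
  have "inner A X = inner B X" for X
    using assms[of "flip X"] by (simp add: pairing_eq_inner)
  then show ?thesis
    by (rule vector_eq_rdot[THEN iffD1, OF allI])
qed

lemma pairing_hs_comp: "pairing (hs_comp A B) C = pairing A (hs_comp B C)"
proof -
  obtain E :: "real L2 set" where E: "orthonormal_basis E"
    using orthonormal_basis_exists by blast
  show ?thesis
    using has_sum_pairing[OF E, of "hs_comp A B" C] has_sum_pairing[OF E, of A "hs_comp B C"]
    by (auto simp: int_op_hs_comp intro: has_sum_unique)
qed

text \<open>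
  The pairing is ad-invariant: it is symmetric, and under the trace the composition may be bracketed
  arbitrarily.
\<close>

lemma pairing_bracket: "pairing (bracket A B) C = pairing A (bracket B C)"
proof -
  have "pairing (hs_comp B A) C = pairing A (hs_comp C B)"
    by (metis pairing_hs_comp pairing_commute)
  then show ?thesis
    by (simp add: bracket_def pairing.diff_left pairing.diff_right pairing_hs_comp)
qed

lemma int_op_hs_power: "j \<ge> 1 \<Longrightarrow> int_op (hs_power K j) = int_op K ^^ j"
proof (induction j rule: nat_induct_at_least)
  case base
  show ?case
    by (simp add: hs_power_def)
next
  case (Suc j)
  have "int_op K ^^ Suc j = int_op (hs_comp K (hs_power K j))"
    using Suc.IH by (simp add: int_op_hs_comp)
  then show ?case
    by (metis hs_power_def kernel_int_op)
qed

lemma hs_power_1 [simp]: "hs_power K (Suc 0) = K"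
  by (simp add: hs_power_def)

lemma hs_power_Suc: "j \<ge> 1 \<Longrightarrow> hs_power K (Suc j) = hs_comp K (hs_power K j)"
  by (rule int_op_inject[THEN iffD1]) (simp add: int_op_hs_power int_op_hs_comp)

lemma hs_power_add:
  "i \<ge> 1 \<Longrightarrow> j \<ge> 1 \<Longrightarrow> hs_comp (hs_power K i) (hs_power K j) = hs_power K (i + j)"
  by (rule int_op_inject[THEN iffD1]) (simp add: int_op_hs_power int_op_hs_comp funpow_add)

lemma bracket_hs_power: "j \<ge> 1 \<Longrightarrow> bracket K (hs_power K j) = 0"
  using hs_power_add[of 1 j K] hs_power_add[of j 1 K] by (simp add: bracket_def)

lemma H_fun_eq: "j \<ge> 1 \<Longrightarrow> H_fun j K = 1 / (2 * (real j + 1)) * pairing K (hs_power K j)"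
  using trace_int_op_comp[of K "hs_power K j"] by (simp add: H_fun_def int_op_hs_power)

section \<open>Homogeneous polynomials are smooth\<close>

definition bounded_multilinear_form :: "nat \<Rightarrow> ('a::real_normed_vector list \<Rightarrow> real) \<Rightarrow> bool" where
  "bounded_multilinear_form n M \<longleftrightarrow>
     (\<forall>vs i. length vs = n \<and> i < n \<longrightarrow> linear (\<lambda>v. M (vs[i := v]))) \<and>
     (\<exists>C. \<forall>vs. length vs = n \<longrightarrow> \<bar>M vs\<bar> \<le> C * (\<Prod>v\<leftarrow>vs. norm v))"

text \<open>
  The average over all permutations of the arguments. It does not change the form on the diagonal, and
  derivatives of \<open>x \<mapsto> S (x, \<dots>, x)\<close> have a simple closed form only when \<open>S\<close> is symmetric.
\<close>

definition symmetrization :: "nat \<Rightarrow> ('a list \<Rightarrow> real) \<Rightarrow> 'a list \<Rightarrow> real" where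
  "symmetrization n M vs = (\<Sum>p | p permutes {..<n}. M (permute_list p vs)) / fact n"

lemma prod_list_norm_nonneg: "0 \<le> (\<Prod>v\<leftarrow>vs. norm (v :: 'a::real_normed_vector))"
  by (induction vs) auto

lemma prod_list_permute_list:
  assumes "p permutes {..<length vs}"
  shows "(\<Prod>v\<leftarrow>permute_list p vs. norm v) = (\<Prod>v\<leftarrow>vs. norm v)"
proof -
  have "prod_mset (image_mset norm (mset (permute_list p vs))) = prod_mset (image_mset norm (mset vs))"
    using assms by simp
  then show ?thesis
    by (simp add: prod_mset_prod_list flip: mset_map)
qed

lemma permute_list_update:
  assumes p: "p permutes {..<length vs}" and i: "i < length vs"
  shows "permute_list p (vs[i := v]) = (permute_list p vs)[inv p i := v]"
proof (rule nth_equalityI)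
  fix j
  assume "j < length (permute_list p (vs[i := v]))"
  then have j: "j < length vs"
    by simp
  have pj: "p j < length vs"
    using permutes_in_image[OF p, of j] j by simp
  have "inv p i = j \<longleftrightarrow> i = p j"
    using p by (metis permutes_inverses)
  then show "permute_list p (vs[i := v]) ! j = (permute_list p vs)[inv p i := v] ! j"
    using p i j pj by (auto simp: permute_list_nth nth_list_update)
qed simp

lemma symmetrization_multilinear:
  assumes M: "bounded_multilinear_form n M"
  shows "bounded_multilinear_form n (symmetrization n M)"
  unfolding bounded_multilinear_form_def
proof (intro conjI allI impI)
  fix vs :: "'a list" and i
  assume vs: "length vs = n \<and> i < n"
  have "linear (\<lambda>v. M (permute_list p (vs[i := v])))" if p: "p permutes {..<n}" for p
  proof -
    have "inv p i < n"
      using permutes_in_image[OF permutes_inv[OF p], of i] vs by simp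
    then have "linear (\<lambda>v. M ((permute_list p vs)[inv p i := v]))"
      using M vs by (simp add: bounded_multilinear_form_def)
    then show ?thesis
      using p vs by (simp add: permute_list_update)
  qed
  then have "linear (\<lambda>v. (1 / fact n) *\<^sub>R (\<Sum>p | p permutes {..<n}. M (permute_list p (vs[i := v]))))"
    by (intro linear_compose_scale_right linear_compose_sum ballI) auto
  then show "linear (\<lambda>v. symmetrization n M (vs[i := v]))"
    by (simp add: symmetrization_def)
next
  obtain C where C: "\<And>vs. length vs = n \<Longrightarrow> \<bar>M vs\<bar> \<le> C * (\<Prod>v\<leftarrow>vs. norm v)"
    using M by (auto simp: bounded_multilinear_form_def)
  have "\<bar>symmetrization n M vs\<bar> \<le> C * (\<Prod>v\<leftarrow>vs. norm v)" if vs: "length vs = n" for vs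
  proof -
    have "\<bar>\<Sum>p | p permutes {..<n}. M (permute_list p vs)\<bar> \<le> (\<Sum>p | p permutes {..<n}. C * (\<Prod>v\<leftarrow>vs. norm v))"
    proof (rule order_trans[OF sum_abs], rule sum_mono)
      fix p
      assume "p \<in> {p. p permutes {..<n}}"
      then show "\<bar>M (permute_list p vs)\<bar> \<le> C * (\<Prod>v\<leftarrow>vs. norm v)"
        using C[of "permute_list p vs"] vs prod_list_permute_list[of p vs] by simp
    qed
    also have "\<dots> = fact n * (C * (\<Prod>v\<leftarrow>vs. norm v))"
      using card_permutations[of "{..<n}" n] by simp
    finally show ?thesis
      by (simp add: symmetrization_def field_simps)
  qed
  then show "\<exists>C. \<forall>vs. length vs = n \<longrightarrow> \<bar>symmetrization n M vs\<bar> \<le> C * (\<Prod>v\<leftarrow>vs. norm v)"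
    by blast
qed

lemma symmetrization_cong_mset:
  assumes "length ys = n" "mset xs = mset ys"
  shows "symmetrization n M xs = symmetrization n M ys"
proof -
  obtain p where p: "p permutes {..<length ys}" "permute_list p ys = xs"
    using mset_eq_permutation[OF assms(2)] by blast
  have "(\<Sum>q | q permutes {..<n}. M (permute_list q xs)) = (\<Sum>q | q permutes {..<n}. M (permute_list (p \<circ> q) ys))"
    using p assms(1) by (intro sum.cong) (auto simp: permute_list_compose)
  also have "\<dots> = (\<Sum>q | q permutes {..<n}. M (permute_list q ys))"
    using p(1) assms(1) by (intro setum_permutations_compose_left[symmetric]) simp
  finally show ?thesis
    by (simp add: symmetrization_def)
qed

lemma symmetrization_replicate:
  "symmetrization n M (replicate n x) = M (replicate n x)"
proof -
  have "permute_list p (replicate n x) = replicate n x" if "p permutes {..<n}" for p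
    using that permutes_in_image[OF that]
    by (intro nth_equalityI) (auto simp: permute_list_nth)
  then show ?thesis
    using card_permutations[of "{..<n}" n] by (simp add: symmetrization_def)
qed

context
  fixes n :: nat and S :: "'a::real_normed_vector list \<Rightarrow> real"
  assumes S: "bounded_multilinear_form n S"
    and symmetric: "\<And>xs ys. length ys = n \<Longrightarrow> mset xs = mset ys \<Longrightarrow> S xs = S ys"
begin

lemma form_add_slot:
  assumes "length us + Suc (length ws) = n"
  shows "S (us @ (a + b) # ws) = S (us @ a # ws) + S (us @ b # ws)"
proof -
  have "linear (\<lambda>v. S ((us @ a # ws)[length us := v]))"
    using S assms unfolding bounded_multilinear_form_def by (metis length_append length_Cons less_add_Suc1 add_Suc_right)
  then have "linear (\<lambda>v. S (us @ v # ws))"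
    by simp
  then show ?thesis
    by (rule linear_add)
qed

lemma form_bound:
  obtains C where "0 \<le> C" "\<And>vs. length vs = n \<Longrightarrow> \<bar>S vs\<bar> \<le> C * (\<Prod>v\<leftarrow>vs. norm v)"
proof -
  obtain C where C: "\<And>vs. length vs = n \<Longrightarrow> \<bar>S vs\<bar> \<le> C * (\<Prod>v\<leftarrow>vs. norm v)"
    using S by (auto simp: bounded_multilinear_form_def)
  have "\<bar>S vs\<bar> \<le> max 0 C * (\<Prod>v\<leftarrow>vs. norm v)" if "length vs = n" for vs
    using C[OF that] mult_right_mono[OF max.cobounded2[of C 0] prod_list_norm_nonneg[of vs]] by linarith
  then show thesis
    by (intro that[of "max 0 C"]) auto
qed

text \<open>
  Replace the copies of \<open>x + h\<close> by \<open>x\<close> one at a time, from the left; the entries already treated are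
  moved into \<open>us\<close>. The constant depends on \<open>x\<close> but neither on \<open>us\<close> nor on \<open>h\<close>, as the definition of
  smoothness asks for an estimate uniform in the remaining arguments.
\<close>

lemma form_first_order:
  "\<exists>K\<ge>0. \<forall>us h. length us + m = n \<and> norm h \<le> 1 \<longrightarrow>
     \<bar>S (us @ replicate m (x + h)) - S (us @ replicate m x)\<bar> \<le> K * norm h * (\<Prod>v\<leftarrow>us. norm v)"
proof (induction m)
  case 0
  show ?case
    by (rule exI[of _ 0]) simp
next
  case (Suc m)
  then obtain K where K: "0 \<le> K" "\<And>us h. length us + m = n \<Longrightarrow> norm h \<le> 1 \<Longrightarrow>
     \<bar>S (us @ replicate m (x + h)) - S (us @ replicate m x)\<bar> \<le> K * norm h * (\<Prod>v\<leftarrow>us. norm v)"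
    by auto
  obtain C where C: "0 \<le> C" "\<And>vs. length vs = n \<Longrightarrow> \<bar>S vs\<bar> \<le> C * (\<Prod>v\<leftarrow>vs. norm v)"
    by (rule form_bound) (rule that)
  have "\<bar>S (us @ replicate (Suc m) (x + h)) - S (us @ replicate (Suc m) x)\<bar>
      \<le> (K * norm x + C * (norm x + 1) ^ m) * norm h * (\<Prod>v\<leftarrow>us. norm v)"
    if us: "length us + Suc m = n" and h: "norm h \<le> 1" for us h
  proof -
    let ?P = "\<Prod>v\<leftarrow>us. norm v"
    have P: "0 \<le> ?P"
      by (rule prod_list_norm_nonneg)
    have "S (us @ replicate (Suc m) (x + h)) =
        S ((us @ [x]) @ replicate m (x + h)) + S ((us @ [h]) @ replicate m (x + h))"
      using form_add_slot[of us "replicate m (x + h)" x h] us by simp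
    moreover have "S (us @ replicate (Suc m) x) = S ((us @ [x]) @ replicate m x)"
      by simp
    moreover have "\<bar>S ((us @ [x]) @ replicate m (x + h)) - S ((us @ [x]) @ replicate m x)\<bar>
        \<le> K * norm x * norm h * ?P"
      using K(2)[of "us @ [x]" h] us h by (simp add: mult_ac)
    moreover have "\<bar>S ((us @ [h]) @ replicate m (x + h))\<bar> \<le> C * (norm x + 1) ^ m * norm h * ?P"
    proof -
      have "norm (x + h) \<le> norm x + 1"
        using norm_triangle_ineq[of x h] h by linarith
      then have "norm (x + h) ^ m \<le> (norm x + 1) ^ m"
        by (intro power_mono) auto
      then have "(C * norm h * ?P) * norm (x + h) ^ m \<le> (C * norm h * ?P) * (norm x + 1) ^ m"
        using C(1) P by (intro mult_left_mono) auto
      moreover have "\<bar>S ((us @ [h]) @ replicate m (x + h))\<bar> \<le> (C * norm h * ?P) * norm (x + h) ^ m"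
        using C(2)[of "(us @ [h]) @ replicate m (x + h)"] us
        by (simp add: mult_ac prod_list_replicate)
      ultimately show ?thesis
        by (simp add: mult_ac)
    qed
    ultimately show ?thesis
      by (simp add: distrib_right)
  qed
  moreover have "0 \<le> K * norm x + C * (norm x + 1) ^ m"
    using K(1) C(1) by simp
  ultimately show ?case
    by blast
qed

text \<open>
  The same induction with the linear term subtracted. Moving \<open>h\<close> to the front of the copies of \<open>x\<close> is
  where the symmetry is used.
\<close>

lemma form_second_order:
  "\<exists>K\<ge>0. \<forall>us h. length us + m = n \<and> norm h \<le> 1 \<longrightarrow>
     \<bar>S (us @ replicate m (x + h)) - S (us @ replicate m x) - real m * S (us @ h # replicate (m - 1) x)\<bar>
       \<le> K * (norm h)\<^sup>2 * (\<Prod>v\<leftarrow>us. norm v)"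
proof (induction m)
  case 0
  show ?case
    by (rule exI[of _ 0]) simp
next
  case (Suc m)
  then obtain K where K: "0 \<le> K" "\<And>us h. length us + m = n \<Longrightarrow> norm h \<le> 1 \<Longrightarrow>
     \<bar>S (us @ replicate m (x + h)) - S (us @ replicate m x) - real m * S (us @ h # replicate (m - 1) x)\<bar>
       \<le> K * (norm h)\<^sup>2 * (\<Prod>v\<leftarrow>us. norm v)"
    by auto
  obtain L where L: "0 \<le> L" "\<And>us h. length us + m = n \<Longrightarrow> norm h \<le> 1 \<Longrightarrow>
     \<bar>S (us @ replicate m (x + h)) - S (us @ replicate m x)\<bar> \<le> L * norm h * (\<Prod>v\<leftarrow>us. norm v)"
    using form_first_order[of m x] by auto
  have "\<bar>S (us @ replicate (Suc m) (x + h)) - S (us @ replicate (Suc m) x)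
        - real (Suc m) * S (us @ h # replicate m x)\<bar>
      \<le> (K * norm x + L) * (norm h)\<^sup>2 * (\<Prod>v\<leftarrow>us. norm v)"
    if us: "length us + Suc m = n" and h: "norm h \<le> 1" for us h
  proof -
    let ?P = "\<Prod>v\<leftarrow>us. norm v"
    have "S (us @ replicate (Suc m) (x + h)) =
        S ((us @ [x]) @ replicate m (x + h)) + S ((us @ [h]) @ replicate m (x + h))"
      using form_add_slot[of us "replicate m (x + h)" x h] us by simp
    moreover have "S (us @ replicate (Suc m) x) = S ((us @ [x]) @ replicate m x)"
      by simp
    moreover have "real (Suc m) * S (us @ h # replicate m x) =
        real m * S ((us @ [x]) @ h # replicate (m - 1) x) + S ((us @ [h]) @ replicate m x)"
    proof (cases m)
      case (Suc k)
      have "S (us @ h # replicate m x) = S ((us @ [x]) @ h # replicate (m - 1) x)"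
        using us by (intro symmetric) (auto simp: Suc)
      then show ?thesis
        by (simp add: distrib_right)
    qed simp
    moreover have "\<bar>S ((us @ [x]) @ replicate m (x + h)) - S ((us @ [x]) @ replicate m x)
        - real m * S ((us @ [x]) @ h # replicate (m - 1) x)\<bar> \<le> K * norm x * (norm h)\<^sup>2 * ?P"
      using K(2)[of "us @ [x]" h] us h by (simp add: mult_ac)
    moreover have "\<bar>S ((us @ [h]) @ replicate m (x + h)) - S ((us @ [h]) @ replicate m x)\<bar>
        \<le> L * (norm h)\<^sup>2 * ?P"
      using L(2)[of "us @ [h]" h] us h by (simp add: mult_ac power2_eq_square)
    ultimately show ?thesis
      unfolding distrib_right by linarith
  qed
  moreover have "0 \<le> K * norm x + L"
    using K(1) L(1) by simp
  ultimately show ?case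
    unfolding diff_Suc_1 by blast
qed

text \<open>
  The \<open>k\<close>-th derivative of \<open>x \<mapsto> S (x, \<dots>, x)\<close> in directions \<open>vs\<close> is \<open>n! / (n - k)!\<close> times the value of
  \<open>S\<close> on \<open>vs\<close> followed by \<open>n - k\<close> copies of \<open>x\<close>.
\<close>

lemma smooth_symmetric_form: "smooth (\<lambda>x. S (replicate n x))"
proof -
  define c where "c = (\<lambda>k. fact n / fact (n - k) :: real)"
  define D where "D = (\<lambda>k x vs. if k \<le> n then c k * S (vs @ replicate (n - k) x) else 0)"
  have D_0: "D 0 x [] = S (replicate n x)" for x
    by (simp add: D_def c_def)
  have D_linear: "linear (\<lambda>v. D k x (vs[i := v]))" if "length vs = k \<and> i < k" for k x vs i
  proof (cases "k \<le> n")
    case True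
    then have "linear (\<lambda>v. S ((vs @ replicate (n - k) x)[i := v]))"
      using S that unfolding bounded_multilinear_form_def by simp
    then have "linear (\<lambda>v. S (vs[i := v] @ replicate (n - k) x))"
      using that by (simp add: list_update_append)
    from linear_compose_scale_right[OF this, of "c k"] show ?thesis
      using True by (simp add: D_def)
  qed (simp add: D_def linear_iff)
  have D_bounded: "\<exists>B. \<forall>vs. length vs = k \<longrightarrow> \<bar>D k x vs\<bar> \<le> B * (\<Prod>v\<leftarrow>vs. norm v)" for k x
  proof -
    obtain C where C: "0 \<le> C" "\<And>vs. length vs = n \<Longrightarrow> \<bar>S vs\<bar> \<le> C * (\<Prod>v\<leftarrow>vs. norm v)"
      by (rule form_bound) (rule that)
    have "\<bar>D k x vs\<bar> \<le> (c k * C * norm x ^ (n - k)) * (\<Prod>v\<leftarrow>vs. norm v)" if "length vs = k" for vs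
    proof (cases "k \<le> n")
      case True
      then have "\<bar>S (vs @ replicate (n - k) x)\<bar> \<le> C * norm x ^ (n - k) * (\<Prod>v\<leftarrow>vs. norm v)"
        using C(2)[of "vs @ replicate (n - k) x"] that by (simp add: prod_list_replicate mult_ac)
      then have "c k * \<bar>S (vs @ replicate (n - k) x)\<bar> \<le> c k * (C * norm x ^ (n - k) * (\<Prod>v\<leftarrow>vs. norm v))"
        by (intro mult_left_mono) (auto simp: c_def)
      then show ?thesis
        using True by (simp add: D_def abs_mult c_def mult_ac)
    next
      case False
      then show ?thesis
        using C(1) prod_list_norm_nonneg[of vs] by (simp add: D_def c_def)
    qed
    then show ?thesis
      by blast
  qed
  have D_derivative: "\<exists>d>0. \<forall>h vs. length vs = k \<and> norm h < d \<longrightarrow>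
      \<bar>D k (x + h) vs - D k x vs - D (Suc k) x (h # vs)\<bar> \<le> e * norm h * (\<Prod>v\<leftarrow>vs. norm v)"
    if "0 < e" for k x and e :: real
  proof (cases "k < n")
    case True
    obtain K where K: "0 \<le> K" "\<And>us h. length us + (n - k) = n \<Longrightarrow> norm h \<le> 1 \<Longrightarrow>
       \<bar>S (us @ replicate (n - k) (x + h)) - S (us @ replicate (n - k) x)
          - real (n - k) * S (us @ h # replicate (n - k - 1) x)\<bar>
         \<le> K * (norm h)\<^sup>2 * (\<Prod>v\<leftarrow>us. norm v)"
      using form_second_order[of "n - k" x] by auto
    have c0: "0 \<le> c k"
      by (simp add: c_def)
    define d where "d = min 1 (e / (c k * K + 1))"
    have cK: "0 < c k * K + 1"
      using c0 K(1) by (simp add: add_nonneg_pos)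
    have "0 < d"
      using \<open>0 < e\<close> cK by (simp add: d_def)
    moreover have "\<bar>D k (x + h) vs - D k x vs - D (Suc k) x (h # vs)\<bar> \<le> e * norm h * (\<Prod>v\<leftarrow>vs. norm v)"
      if vs: "length vs = k" and h: "norm h < d" for h vs
    proof -
      let ?P = "\<Prod>v\<leftarrow>vs. norm v"
      have "n - k = Suc (n - Suc k)"
        using True by simp
      then have c_Suc: "c (Suc k) = c k * real (n - k)"
        by (simp add: c_def)
      have S_swap: "S ((h # vs) @ replicate (n - Suc k) x) = S (vs @ h # replicate (n - k - 1) x)"
        using vs True by (intro symmetric) auto
      have "D (Suc k) x (h # vs) = c k * (real (n - k) * S (vs @ h # replicate (n - k - 1) x))"
        unfolding D_def using True by (simp only: c_Suc S_swap if_True Suc_le_eq mult.assoc)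
      then have "D k (x + h) vs - D k x vs - D (Suc k) x (h # vs) =
          c k * (S (vs @ replicate (n - k) (x + h)) - S (vs @ replicate (n - k) x)
            - real (n - k) * S (vs @ h # replicate (n - k - 1) x))"
        using True by (simp add: D_def right_diff_distrib)
      then have "\<bar>D k (x + h) vs - D k x vs - D (Suc k) x (h # vs)\<bar> \<le> c k * (K * (norm h)\<^sup>2 * ?P)"
        using K(2)[of vs h] vs h True c0 by (simp add: abs_mult d_def mult_left_mono)
      also have "\<dots> = (c k * K * norm h) * (norm h * ?P)"
        by (simp add: power2_eq_square)
      also have "\<dots> \<le> e * (norm h * ?P)"
      proof (rule mult_right_mono)
        have "c k * K * norm h \<le> (c k * K + 1) * norm h"
          by (simp add: distrib_right)
        also have "\<dots> \<le> (c k * K + 1) * (e / (c k * K + 1))"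
          using h cK by (intro mult_left_mono) (auto simp: d_def)
        also have "\<dots> = e"
          using cK by simp
        finally show "c k * K * norm h \<le> e" .
        show "0 \<le> norm h * ?P"
          by (simp add: prod_list_norm_nonneg)
      qed
      finally show ?thesis
        by (simp add: mult_ac)
    qed
    ultimately show ?thesis
      by blast
  next
    case False
    then have "D k (x + h) vs - D k x vs - D (Suc k) x (h # vs) = 0" for h vs
      by (simp add: D_def)
    then show ?thesis
      using \<open>0 < e\<close> by (intro exI[of _ 1]) (simp add: prod_list_norm_nonneg)
  qed
  show ?thesis
    unfolding smooth_def
    by (intro exI[of _ D] conjI allI) (simp_all add: D_0 D_linear D_bounded D_derivative)
qed

end

lemma smooth_multilinear_form:
  assumes "bounded_multilinear_form n M"
  shows "smooth (\<lambda>x. M (replicate n x))"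
proof -
  have "smooth (\<lambda>x. symmetrization n M (replicate n x))"
    by (rule smooth_symmetric_form[OF symmetrization_multilinear[OF assms] symmetrization_cong_mset])
  then show ?thesis
    by (simp add: symmetrization_replicate)
qed

lemma smooth_bounded_linear:
  assumes "bounded_linear f"
  shows "smooth f"
proof -
  interpret bounded_linear f by fact
  have "bounded_multilinear_form 1 (\<lambda>vs. f (hd vs))"
    unfolding bounded_multilinear_form_def
  proof (intro conjI allI impI)
    fix vs :: "'a list" and i :: nat
    assume "length vs = 1 \<and> i < 1"
    then have "(\<lambda>v. f (hd (vs[i := v]))) = f"
      by (cases vs) auto
    then show "linear (\<lambda>v. f (hd (vs[i := v])))"
      by (simp add: linear)
  next
    obtain B where B: "\<And>x. norm (f x) \<le> norm x * B"
      using bounded by blast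
    then have "\<bar>f (hd vs)\<bar> \<le> B * (\<Prod>v\<leftarrow>vs. norm v)" if "length vs = 1" for vs
      using that by (cases vs) (auto simp: mult.commute)
    then show "\<exists>C. \<forall>vs. length vs = 1 \<longrightarrow> \<bar>f (hd vs)\<bar> \<le> C * (\<Prod>v\<leftarrow>vs. norm v)"
      by blast
  qed
  from smooth_multilinear_form[OF this] show ?thesis
    by simp
qed

lemma smooth_has_derivative:
  assumes "smooth F"
  obtains l where "(F has_derivative l) (at x)"
proof -
  from assms obtain D where D0: "\<And>x. D 0 x [] = F x"
    and lin: "\<And>k x vs i. length vs = k \<and> i < k \<Longrightarrow> linear (\<lambda>v. D k x (vs[i := v]))"
    and bnd: "\<And>k x. \<exists>C. \<forall>vs. length vs = k \<longrightarrow> \<bar>D k x vs\<bar> \<le> C * (\<Prod>v\<leftarrow>vs. norm v)"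
    and der: "\<And>k x e. e > 0 \<Longrightarrow> \<exists>d>0. \<forall>h vs. length vs = k \<and> norm h < d \<longrightarrow>
        \<bar>D k (x + h) vs - D k x vs - D (Suc k) x (h # vs)\<bar> \<le> e * norm h * (\<Prod>v\<leftarrow>vs. norm v)"
    unfolding smooth_def by auto
  have l: "linear (\<lambda>v. D (Suc 0) x [v])"
    using lin[of "[0]" "Suc 0" 0 x] by simp
  obtain C where "\<forall>vs. length vs = Suc 0 \<longrightarrow> \<bar>D (Suc 0) x vs\<bar> \<le> C * (\<Prod>v\<leftarrow>vs. norm v)"
    using bnd by blast
  then have "norm (D (Suc 0) x [v]) \<le> norm v * C" for v
    by (auto dest: spec[of _ "[v]"] simp: mult.commute)
  then have "bounded_linear (\<lambda>v. D (Suc 0) x [v])"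
    using l by (intro bounded_linear_intro[where K = C]) (simp_all add: linear_add[OF l] linear_scale[OF l, simplified])
  moreover have "\<exists>d>0. \<forall>y. norm (y - x) < d \<longrightarrow> norm (F y - F x - D (Suc 0) x [y - x]) \<le> e * norm (y - x)"
    if e: "0 < e" for e
  proof -
    obtain d where "d > 0" and d: "\<And>h. norm h < d \<Longrightarrow> \<bar>F (x + h) - F x - D (Suc 0) x [h]\<bar> \<le> e * norm h"
      using der[OF e, of 0 x] by (auto simp: D0)
    then show ?thesis
      using d[of "y - x" for y] by (intro exI[of _ d]) auto
  qed
  ultimately have "(F has_derivative (\<lambda>v. D (Suc 0) x [v])) (at x)"
    by (simp add: has_derivative_at_alt)
  then show thesis
    by (rule that)
qed

section \<open>Gradients\<close>

lemma grad_eqI: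
  assumes "(F has_derivative (\<lambda>X. pairing A X)) (at K)"
  shows "grad F K = A"
  unfolding grad_def
proof (rule the_equality)
  have dir: "((\<lambda>t. F (K + t *\<^sub>R X)) has_real_derivative pairing A X) (at 0)" for X
  proof -
    have "((\<lambda>t. K + t *\<^sub>R X) has_derivative (\<lambda>t. t *\<^sub>R X)) (at 0)"
      by (auto intro!: derivative_eq_intros)
    moreover have "(F has_derivative (\<lambda>X. pairing A X)) (at (K + 0 *\<^sub>R X))"
      using assms by simp
    ultimately have "((\<lambda>t. F (K + t *\<^sub>R X)) has_derivative (\<lambda>t. pairing A (t *\<^sub>R X))) (at 0)"
      by (rule has_derivative_compose)
    then show ?thesis
      by (simp add: has_field_derivative_def pairing.scaleR_right mult.commute[of _ "pairing A X"])
  qed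
  then show "\<forall>X. ((\<lambda>t. F (K + t *\<^sub>R X)) has_real_derivative pairing A X) (at 0)"
    by simp
  show "B = A" if "\<forall>X. ((\<lambda>t. F (K + t *\<^sub>R X)) has_real_derivative pairing B X) (at 0)" for B
  proof (rule pairing_nondegenerate)
    show "pairing B X = pairing A X" for X
      by (rule DERIV_unique[OF that[rule_format] dir])
  qed
qed

text \<open>
  The Frechet derivative is a bounded functional. Its Riesz representative has to be transposed, since
  the pairing is the inner product with the transpose.
\<close>

lemma smooth_has_derivative_grad:
  assumes "smooth F"
  shows "(F has_derivative (\<lambda>X. pairing (grad F K) X)) (at K)"
proof -
  obtain l where l: "(F has_derivative l) (at K)"
    by (rule smooth_has_derivative[OF assms]) (rule that)
  obtain p where "\<And>X. inner p X = l X"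
    by (rule Riesz_representation[OF has_derivative_bounded_linear[OF l]]) (rule that)
  then have "l = (\<lambda>X. pairing (flip p) X)"
    by (simp add: fun_eq_iff pairing_eq_inner inner_flip_left)
  with l have "(F has_derivative (\<lambda>X. pairing (flip p) X)) (at K)"
    by simp
  then show ?thesis
    using grad_eqI by metis
qed

lemma smooth_pairing: "smooth (\<lambda>X. pairing A X)"
  by (rule smooth_bounded_linear[OF pairing.bounded_linear_right])

lemma grad_pairing: "grad (\<lambda>X. pairing A X) K = A"
  by (rule grad_eqI) (rule bounded_linear_imp_has_derivative[OF pairing.bounded_linear_right])

section \<open>Traces of powers\<close>

fun comp_list :: "hs list \<Rightarrow> hs" where
  "comp_list [] = 0"
| "comp_list [A] = A"
| "comp_list (A # B # As) = hs_comp A (comp_list (B # As))"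

lemma comp_list_Cons: "As \<noteq> [] \<Longrightarrow> comp_list (A # As) = hs_comp A (comp_list As)"
  by (cases As) auto

lemma linear_comp_list: "i < length As \<Longrightarrow> linear (\<lambda>X. comp_list (As[i := X]))"
proof (induction As arbitrary: i rule: comp_list.induct)
  case (2 A)
  then show ?case
    by (simp add: linear_iff)
next
  case (3 A B As)
  show ?case
  proof (cases i)
    case 0
    then show ?thesis
      using bounded_linear.linear[OF hs_comp.bounded_linear_left] by simp
  next
    case (Suc i')
    have "linear (\<lambda>X. hs_comp A (comp_list ((B # As)[i' := X])))"
      using linear_compose[OF "3.IH"[of i'] bounded_linear.linear[OF hs_comp.bounded_linear_right[of A]]]
        "3.prems" Suc by (simp add: o_def)
    moreover have "comp_list ((A # B # As)[i := X]) = hs_comp A (comp_list ((B # As)[i' := X]))" for X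
      by (simp add: Suc comp_list_Cons split: nat.split)
    ultimately show ?thesis
      by simp
  qed
qed simp

lemma norm_comp_list_le: "norm (comp_list As) \<le> (\<Prod>A\<leftarrow>As. norm A)"
proof (induction As rule: comp_list.induct)
  case (3 A B As)
  have "norm (hs_comp A (comp_list (B # As))) \<le> norm A * norm (comp_list (B # As))"
    by (rule norm_hs_comp_le)
  also have "\<dots> \<le> norm A * (\<Prod>A\<leftarrow>(B # As). norm A)"
    using "3.IH" by (intro mult_left_mono) auto
  finally show ?case
    by simp
qed auto

lemma comp_list_replicate: "j \<ge> 1 \<Longrightarrow> comp_list (replicate j K) = hs_power K j"
proof (induction j rule: nat_induct_at_least)
  case (Suc j)
  then show ?case
    by (simp add: comp_list_Cons hs_power_Suc)
qed simp

text \<open>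
  The multilinear form whose value at \<open>A\<^sub>1, \<dots>, A\<^sub>n\<close> is the trace of the product, for \<open>n \<ge> 2\<close>.
\<close>

definition trace_form :: "hs list \<Rightarrow> real" where
  "trace_form As = pairing (hd As) (comp_list (tl As))"

lemma trace_form_multilinear:
  assumes "j \<ge> 1"
  shows "bounded_multilinear_form (Suc j) trace_form"
  unfolding bounded_multilinear_form_def
proof (intro conjI allI impI)
  fix As :: "hs list" and i
  assume As: "length As = Suc j \<and> i < Suc j"
  then obtain A Bs where ABs: "As = A # Bs" "length Bs = j"
    by (cases As) auto
  show "linear (\<lambda>X. trace_form (As[i := X]))"
  proof (cases i)
    case 0
    then show ?thesis
      using bounded_linear.linear[OF pairing.bounded_linear_left] by (simp add: trace_form_def ABs)
  next
    case (Suc i')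
    then show ?thesis
      using linear_compose[OF linear_comp_list[of i' Bs] bounded_linear.linear[OF pairing.bounded_linear_right[of A]]] As
      by (simp add: trace_form_def ABs o_def)
  qed
next
  have "\<bar>trace_form As\<bar> \<le> 1 * (\<Prod>A\<leftarrow>As. norm A)" if len: "length As = Suc j" for As
  proof -
    obtain A Bs where As: "As = A # Bs"
      using len by (cases As) auto
    have "\<bar>pairing A (comp_list Bs)\<bar> \<le> norm A * norm (comp_list Bs)"
      by (rule abs_pairing_le)
    also have "\<dots> \<le> norm A * (\<Prod>A\<leftarrow>Bs. norm A)"
      by (intro mult_left_mono norm_comp_list_le) simp
    finally show ?thesis
      by (simp add: trace_form_def As)
  qed
  then show "\<exists>C. \<forall>As. length As = Suc j \<longrightarrow> \<bar>trace_form As\<bar> \<le> C * (\<Prod>A\<leftarrow>As. norm A)"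
    by blast
qed

lemma bounded_multilinear_form_scale:
  assumes "bounded_multilinear_form n M"
  shows "bounded_multilinear_form n (\<lambda>vs. c * M vs)"
  unfolding bounded_multilinear_form_def
proof (intro conjI allI impI)
  fix vs :: "'a list" and i
  assume "length vs = n \<and> i < n"
  then have "linear (\<lambda>v. M (vs[i := v]))"
    using assms by (simp add: bounded_multilinear_form_def)
  from linear_compose_scale_right[OF this, of c] show "linear (\<lambda>v. c * M (vs[i := v]))"
    by simp
next
  obtain C where "\<And>vs. length vs = n \<Longrightarrow> \<bar>M vs\<bar> \<le> C * (\<Prod>v\<leftarrow>vs. norm v)"
    using assms by (auto simp: bounded_multilinear_form_def)
  then have "\<bar>c * M vs\<bar> \<le> (\<bar>c\<bar> * C) * (\<Prod>v\<leftarrow>vs. norm v)" if "length vs = n" for vs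
    using that by (simp add: abs_mult mult.assoc mult_left_mono)
  then show "\<exists>C. \<forall>vs. length vs = n \<longrightarrow> \<bar>c * M vs\<bar> \<le> C * (\<Prod>v\<leftarrow>vs. norm v)"
    by blast
qed

lemma smooth_H_fun:
  assumes "j \<ge> 1"
  shows "smooth (H_fun j)"
proof -
  have "smooth (\<lambda>K. 1 / (2 * (real j + 1)) * trace_form (replicate (Suc j) K))"
    by (rule smooth_multilinear_form[OF bounded_multilinear_form_scale[OF trace_form_multilinear[OF assms]]])
  then have "smooth (\<lambda>K. H_fun j K)"
    using assms by (simp add: H_fun_eq trace_form_def comp_list_replicate)
  then show ?thesis
    by simp
qed

text \<open>
  By the product rule, the derivative of \<open>K\<^sup>j\<close> is a sum of words with one letter \<open>X\<close> and \<open>j - 1\<close>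
  letters \<open>K\<close>. Under the trace against a further power of \<open>K\<close> all these words become equal by cyclicity.
  It suffices to carry this consequence through the induction.
\<close>

lemma hs_power_has_derivative:
  assumes "j \<ge> 1"
  shows "\<exists>D. ((\<lambda>K. hs_power K j) has_derivative D) (at K) \<and>
    (\<forall>a\<ge>1. \<forall>X. pairing (hs_power K a) (D X) = real j * pairing (hs_power K (a + j - 1)) X)"
  using assms
proof (induction j rule: nat_induct_at_least)
  case base
  show ?case
    by (intro exI[of _ "\<lambda>X. X"]) simp
next
  case (Suc j)
  then obtain D where D: "((\<lambda>K. hs_power K j) has_derivative D) (at K)"
    and pair: "\<And>a X. a \<ge> 1 \<Longrightarrow> pairing (hs_power K a) (D X) = real j * pairing (hs_power K (a + j - 1)) X"
    by blast
  define D' where "D' = (\<lambda>X. hs_comp K (D X) + hs_comp X (hs_power K j))"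
  have "((\<lambda>K. hs_comp K (hs_power K j)) has_derivative D') (at K)"
    unfolding D'_def by (rule hs_comp.FDERIV[OF has_derivative_ident D])
  then have "((\<lambda>K. hs_power K (Suc j)) has_derivative D') (at K)"
    using Suc.hyps by (simp add: hs_power_Suc)
  moreover have "pairing (hs_power K a) (D' X) = real (Suc j) * pairing (hs_power K (a + Suc j - 1)) X"
    if a: "a \<ge> 1" for a X
  proof -
    have "pairing (hs_power K a) (hs_comp K (D X)) = pairing (hs_power K (a + 1)) (D X)"
      using hs_power_add[OF a, of 1 K] by (simp flip: pairing_hs_comp)
    also have "\<dots> = real j * pairing (hs_power K (a + j)) X"
      using pair[of "a + 1" X] by simp
    finally have "pairing (hs_power K a) (hs_comp K (D X)) = real j * pairing (hs_power K (a + j)) X" .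
    moreover have "pairing (hs_power K a) (hs_comp X (hs_power K j)) = pairing (hs_power K (a + j)) X"
      using hs_power_add[of j a K] a Suc.hyps
      by (simp add: pairing_commute[of "hs_power K a"] pairing_hs_comp pairing_commute[of X] add.commute)
    ultimately show ?thesis
      by (simp add: D'_def pairing.add_right distrib_right)
  qed
  ultimately show ?case
    by blast
qed

lemma grad_H_fun:
  assumes j: "j \<ge> 1"
  shows "grad (H_fun j) K = (1/2) *\<^sub>R hs_power K j"
proof (rule grad_eqI)
  obtain D where D: "((\<lambda>K. hs_power K j) has_derivative D) (at K)"
    and pair: "\<And>a X. a \<ge> 1 \<Longrightarrow> pairing (hs_power K a) (D X) = real j * pairing (hs_power K (a + j - 1)) X"
    using hs_power_has_derivative[OF j] by blast
  have "((\<lambda>K. 1 / (2 * (real j + 1)) * pairing K (hs_power K j)) has_derivative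
      (\<lambda>X. 1 / (2 * (real j + 1)) * (pairing K (D X) + pairing X (hs_power K j)))) (at K)"
    by (intro has_derivative_mult_right pairing.FDERIV has_derivative_ident D)
  moreover have "pairing K (D X) = real j * pairing (hs_power K j) X" for X
    using pair[of 1 X] by simp
  then have "1 / (2 * (real j + 1)) * (pairing K (D X) + pairing X (hs_power K j)) =
      pairing ((1/2) *\<^sub>R hs_power K j) X" for X
    by (simp add: pairing_commute[of X] pairing.scaleR_left divide_simps) (simp add: algebra_simps)
  moreover have "H_fun j = (\<lambda>K. 1 / (2 * (real j + 1)) * pairing K (hs_power K j))"
    using j by (simp add: fun_eq_iff H_fun_eq)
  ultimately show "(H_fun j has_derivative (\<lambda>X. pairing ((1/2) *\<^sub>R hs_power K j) X)) (at K)"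
    by simp
qed

section \<open>The triangular splitting\<close>

text \<open>
  The two strict triangles. The diagonal is a null set, so together they make up the whole kernel.
\<close>

definition lower_part :: "hs \<Rightarrow> hs" where
  "lower_part A = abs_L2 (\<lambda>z. if snd z < fst z then rep_L2 A z else 0)"

definition upper_part :: "hs \<Rightarrow> hs" where
  "upper_part A = abs_L2 (\<lambda>z. if fst z < snd z then rep_L2 A z else 0)"

lemma square_integrable_restrict:
  assumes f: "square_integrable f" and [measurable]: "Measurable.pred borel P"
  shows "square_integrable (\<lambda>z. if P z then f z else 0)"
proof -
  have [measurable]: "f \<in> borel_measurable borel"
    using f by (simp add: square_integrable_def)
  have "integrable lborel (\<lambda>z. (if P z then f z else 0)\<^sup>2)"
    by (rule Bochner_Integration.integrable_bound[of _ "\<lambda>z. (f z)\<^sup>2"])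
      (use f in \<open>auto simp: square_integrable_def\<close>)
  then show ?thesis
    by (simp add: square_integrable_def)
qed

lemma square_integrable_lower: "square_integrable (\<lambda>z. if snd z < fst z then rep_L2 A z else 0)"
  and square_integrable_upper: "square_integrable (\<lambda>z. if fst z < snd z then rep_L2 A z else 0)"
  for A :: hs
  by (rule square_integrable_restrict; simp)+

lemma rep_lower: "AE z in lborel. rep_L2 (lower_part A) z = (if snd z < fst z then rep_L2 A z else 0)"
  unfolding lower_part_def by (rule rep_abs_L2[OF square_integrable_lower])

lemma rep_upper: "AE z in lborel. rep_L2 (upper_part A) z = (if fst z < snd z then rep_L2 A z else 0)"
  unfolding upper_part_def by (rule rep_abs_L2[OF square_integrable_upper])

lemma inner_lower_left:
  "inner (lower_part A) B = (\<integral>z. (if snd z < fst z then rep_L2 A z * rep_L2 B z else 0) \<partial>lborel)"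
  using inner_L2_abs[OF square_integrable_lower square_integrable_rep, of A B]
  by (simp add: lower_part_def abs_rep_L2 if_distrib[of "\<lambda>u. u * _"] cong: if_cong)

lemma inner_lower: "inner (lower_part A) B = inner A (lower_part B)"
  unfolding inner_commute[of A "lower_part B"] inner_lower_left by (simp add: mult.commute cong: if_cong)

lemma linear_lower: "linear lower_part"
proof (rule linearI)
  show "lower_part (A + B) = lower_part A + lower_part B" for A B
    by (rule vector_eq_rdot[THEN iffD1, OF allI]) (simp add: inner_lower inner_add_left)
  show "lower_part (c *\<^sub>R A) = c *\<^sub>R lower_part A" for c A
    by (rule vector_eq_rdot[THEN iffD1, OF allI]) (simp add: inner_lower)
qed

lemma lower_lower: "lower_part (lower_part A) = lower_part A"
proof (rule L2_eqI)
  show "AE z in lborel. rep_L2 (lower_part (lower_part A)) z = rep_L2 (lower_part A) z"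
    using rep_lower[of "lower_part A"] rep_lower[of A] by eventually_elim simp
qed

lemma lower_upper: "lower_part (upper_part A) = 0"
proof -
  have "AE z in lborel. rep_L2 (lower_part (upper_part A)) z = rep_L2 (lower_part (0 *\<^sub>R upper_part A)) z"
    using rep_lower[of "upper_part A"] rep_lower[of "0 *\<^sub>R upper_part A"] rep_upper[of A] rep_L2_scaleR[of 0 "upper_part A"]
    by eventually_elim simp
  then have "lower_part (upper_part A) = lower_part (0 *\<^sub>R upper_part A)"
    by (rule L2_eqI)
  then show ?thesis
    by (simp add: linear_0[OF linear_lower])
qed

lemma AE_off_diagonal: "AE z :: real \<times> real in lborel. fst z \<noteq> snd z"
  unfolding lborel_prod[symmetric]
proof (rule lborel_pair.AE_pair_measure)
  show "{z \<in> space (lborel \<Otimes>\<^sub>M lborel). fst z \<noteq> snd z} \<in> sets (lborel \<Otimes>\<^sub>M lborel :: (real \<times> real) measure)"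
    unfolding lborel_prod by measurable
  show "AE x :: real in lborel. AE y in lborel. fst (x, y) \<noteq> snd (x, y)"
    using AE_lborel_singleton by (auto simp: eq_commute)
qed

lemma lower_add_upper: "lower_part A + upper_part A = A"
proof (rule L2_eqI)
  show "AE z in lborel. rep_L2 (lower_part A + upper_part A) z = rep_L2 A z"
    using rep_L2_add[of "lower_part A" "upper_part A"] rep_lower[of A] rep_upper[of A] AE_off_diagonal
    by eventually_elim auto
qed

lemma flip_lower: "flip (lower_part A) = upper_part (flip A)"
proof -
  have "inner (upper_part (flip A)) (flip B) = inner (lower_part A) B" for B
  proof -
    have "inner (upper_part (flip A)) (flip B) =
        (\<integral>z. (if fst z < snd z then rep_L2 A (snd z, fst z) * rep_L2 B (snd z, fst z) else 0) \<partial>lborel)"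
      unfolding inner_L2_rep
    proof (rule integral_cong_AE)
      show "AE z in lborel. rep_L2 (upper_part (flip A)) z * rep_L2 (flip B) z =
          (if fst z < snd z then rep_L2 A (snd z, fst z) * rep_L2 B (snd z, fst z) else 0)"
        using rep_upper[of "flip A"] rep_flip[of A] rep_flip[of B] by eventually_elim simp
    qed simp_all
    also have "\<dots> = inner (lower_part A) B"
      using integral_swap[of "\<lambda>z. if snd z < fst z then rep_L2 A z * rep_L2 B z else 0"]
      by (simp add: inner_lower_left)
    finally show ?thesis .
  qed
  from this[of "flip B" for B] have "inner (flip (lower_part A)) B = inner (upper_part (flip A)) B" for B
    by (simp add: inner_flip_left)
  then show ?thesis
    by (rule vector_eq_rdot[THEN iffD1, OF allI])
qed

lemma volterra_iff: "A \<in> volterra \<longleftrightarrow> lower_part A = A"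
proof
  assume "A \<in> volterra"
  then have *: "AE z in lborel. fst z < snd z \<longrightarrow> rep_L2 A z = 0"
    by (simp add: volterra_def case_prod_beta')
  show "lower_part A = A"
  proof (rule L2_eqI)
    show "AE z in lborel. rep_L2 (lower_part A) z = rep_L2 A z"
      using rep_lower[of A] * AE_off_diagonal by eventually_elim auto
  qed
next
  assume *: "lower_part A = A"
  have "AE z in lborel. fst z < snd z \<longrightarrow> rep_L2 A z = 0"
    using rep_lower[of A] unfolding * by eventually_elim auto
  then show "A \<in> volterra"
    by (simp add: volterra_def case_prod_beta')
qed

lemma skew_iff: "B \<in> skew \<longleftrightarrow> flip B = - B"
proof -
  have "adjoint (int_op B) = int_op (flip B)"
    by (rule adjoint_unique) (simp add: int_op_adjoint)
  moreover have "(\<lambda>\<phi>. - int_op B \<phi>) = int_op (- B)"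
    by (simp add: fun_eq_iff int_op_minus_kernel)
  ultimately show ?thesis
    by (simp add: skew_def int_op_inject)
qed

text \<open>
  If \<open>A - L\<close> is skew, then \<open>A + A\<^sup>* = L + L\<^sup>*\<close>, and a Volterra kernel \<open>L\<close> is the lower part of the
  right-hand side because \<open>L\<^sup>*\<close> is upper triangular.
\<close>

lemma volterra_skew_decomposition:
  "L \<in> volterra \<and> A - L \<in> skew \<longleftrightarrow> L = lower_part (A + flip A)"
proof
  assume "L \<in> volterra \<and> A - L \<in> skew"
  then have L: "lower_part L = L" and "flip (A - L) = - (A - L)"
    by (simp_all add: volterra_iff skew_iff)
  then have "A + flip A = L + flip L"
    by (simp add: linear_diff[OF flip_linear] algebra_simps)
  moreover have "lower_part (flip L) = 0"
    using flip_lower[of L] L lower_upper by metis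
  ultimately show "L = lower_part (A + flip A)"
    using L by (simp add: linear_add[OF linear_lower])
next
  assume L: "L = lower_part (A + flip A)"
  have "flip L = upper_part (A + flip A)"
    by (simp add: L flip_lower linear_add[OF flip_linear] add.commute)
  then have "L + flip L = A + flip A"
    by (simp add: L lower_add_upper)
  then have "flip (A - L) = - (A - L)"
    by (simp add: linear_diff[OF flip_linear] algebra_simps)
  then show "L \<in> volterra \<and> A - L \<in> skew"
    by (simp add: volterra_iff skew_iff L lower_lower)
qed

lemma proj_l_eq: "proj_l A = lower_part (A + flip A)"
  by (simp add: proj_l_def volterra_skew_decomposition)

lemma proj_k_eq: "proj_k A = A - proj_l A"
proof -
  have "B \<in> skew \<and> A - B \<in> volterra \<longleftrightarrow> B = A - lower_part (A + flip A)" for B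
    using volterra_skew_decomposition[of "A - B" A] by (auto simp: algebra_simps)
  then show ?thesis
    by (simp add: proj_k_def proj_l_eq)
qed

lemma R_op_eq: "R_op A = 2 *\<^sub>R proj_l A - A"
  by (simp add: R_op_def proj_k_eq scaleR_2)

text \<open>
  The dual map exists because the lower part is a self-adjoint and the transposition an isometric
  operation; the description is unique by non-degeneracy.
\<close>

lemma pairing_dual_map_R_op: "pairing (R_op A) B = pairing A (dual_map R_op B)"
proof -
  define S where "S = (\<lambda>B. flip (2 *\<^sub>R (lower_part (flip B) + flip (lower_part (flip B))) - flip B))"
  have S: "pairing (R_op A) B = pairing A (S B)" for A B
    by (simp add: S_def pairing_eq_inner R_op_eq proj_l_eq inner_diff_left inner_diff_right
        inner_lower inner_add_left inner_add_right inner_flip_left)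
  have "dual_map R_op = S"
    unfolding dual_map_def
  proof (rule the_equality)
    show "T = S" if T: "\<forall>A B. pairing (R_op A) B = pairing A (T B)" for T
    proof
      show "T B = S B" for B
        by (rule pairing_nondegenerate) (use S T in \<open>simp add: pairing_commute[of _ X for X]\<close>)
    qed
  qed (simp add: S)
  then show ?thesis
    by (simp add: S)
qed

section \<open>The equation of motion\<close>

lemma bracket_commute: "bracket A B = - bracket B A"
  by (simp add: bracket_def)

lemma dual_map_R_op_minus: "dual_map R_op (- B) = - dual_map R_op B"
proof (rule pairing_nondegenerate)
  fix X
  show "pairing (dual_map R_op (- B)) X = pairing (- dual_map R_op B) X"
    by (metis pairing_dual_map_R_op pairing_commute pairing.minus_left)
qed

definition hamiltonian_field :: "(hs \<Rightarrow> real) \<Rightarrow> hs \<Rightarrow> hs" where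
  "hamiltonian_field H K = (1/2) *\<^sub>R bracket (R_op (grad H K)) K
     - (1/2) *\<^sub>R dual_map R_op (bracket K (grad H K))"

lemma poisson_R_eq: "poisson_R F H K = pairing (grad F K) (hamiltonian_field H K)"
proof -
  let ?f = "grad F K" and ?h = "grad H K"
  have "pairing K (bracket (R_op ?f) ?h) = pairing ?f (dual_map R_op (bracket ?h K))"
    by (metis pairing_commute pairing_bracket pairing_dual_map_R_op)
  also have "dual_map R_op (bracket ?h K) = - dual_map R_op (bracket K ?h)"
    by (subst bracket_commute) (rule dual_map_R_op_minus)
  finally have "pairing K (bracket (R_op ?f) ?h) = - pairing ?f (dual_map R_op (bracket K ?h))"
    by (simp add: pairing.minus_right)
  moreover have "pairing K (bracket ?f (R_op ?h)) = pairing ?f (bracket (R_op ?h) K)"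
    by (metis pairing_commute pairing_bracket)
  ultimately show ?thesis
    by (simp add: poisson_R_def bracket_R_def hamiltonian_field_def pairing.scaleR_right
        pairing.add_right pairing.diff_right)
qed

lemma dual_map_R_op_0: "dual_map R_op 0 = 0"
  using dual_map_R_op_minus[of 0] by (simp add: eq_neg_iff_add_eq_0 flip: scaleR_2)

lemma bracket_scaleR_left: "bracket (c *\<^sub>R A) B = c *\<^sub>R bracket A B"
  and bracket_scaleR_right: "bracket A (c *\<^sub>R B) = c *\<^sub>R bracket A B"
  by (simp_all add: bracket_def hs_comp.scaleR_left hs_comp.scaleR_right scaleR_diff_right)

lemma bracket_diff_left: "bracket (A - B) C = bracket A C - bracket B C"
  by (simp add: bracket_def hs_comp.diff_left hs_comp.diff_right)

lemma proj_l_scaleR: "proj_l (c *\<^sub>R A) = c *\<^sub>R proj_l A"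
  by (simp add: proj_l_eq linear_scale[OF flip_linear] linear_scale[OF linear_lower] flip: scaleR_add_right)

lemma hamiltonian_field_H_fun:
  assumes "j \<ge> 1"
  shows "hamiltonian_field (H_fun j) K = (1/2) *\<^sub>R bracket (proj_l (hs_power K j)) K"
proof -
  have "bracket (hs_power K j) K = 0"
    using bracket_hs_power[OF assms, of K] bracket_commute[of "hs_power K j" K] by simp
  then have "bracket (R_op (grad (H_fun j) K)) K = bracket (proj_l (hs_power K j)) K"
    by (simp add: R_op_eq grad_H_fun[OF assms] proj_l_scaleR bracket_diff_left bracket_scaleR_left)
  then show ?thesis
    by (simp add: hamiltonian_field_def grad_H_fun[OF assms] bracket_scaleR_right
        bracket_hs_power[OF assms] dual_map_R_op_0)
qed

text \<open>
  Testing the motion with the linear functions \<open>(A, \<cdot>)\<close> determines the derivative of the curve. An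
  interval with interior points has no isolated points, hence derivatives within it are unique.
\<close>

lemma hamiltonian_motion_iff:
  assumes H: "smooth H" and I: "is_interval I" "interior I \<noteq> {}"
  shows "hamiltonian_motion H I K \<longleftrightarrow>
    (\<forall>t\<in>I. (K has_vector_derivative hamiltonian_field H (K t)) (at t within I))"
proof
  assume motion: "hamiltonian_motion H I K"
  show "\<forall>t\<in>I. (K has_vector_derivative hamiltonian_field H (K t)) (at t within I)"
  proof
    fix t
    assume t: "t \<in> I"
    have "I \<noteq> {x}" for x
      using I(2) by auto
    then have "t islimpt I"
      using connected_imp_perfect[of I t] t I(1) by (auto simp: is_interval_connected_1)
    then have nontrivial: "at t within I \<noteq> bot"
      by (simp add: trivial_limit_within)
    define V where "V = vector_derivative K (at t within I)"
    have V: "(K has_vector_derivative V) (at t within I)"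
      using motion t unfolding V_def hamiltonian_motion_def by (simp add: vector_derivative_works)
    have "pairing V A = pairing (hamiltonian_field H (K t)) A" for A
    proof -
      have "((\<lambda>s. pairing A (K s)) has_vector_derivative pairing A V) (at t within I)"
        by (rule bounded_linear.has_vector_derivative[OF pairing.bounded_linear_right V])
      moreover have "((\<lambda>s. pairing A (K s)) has_vector_derivative
          pairing A (hamiltonian_field H (K t))) (at t within I)"
      proof -
        have "((\<lambda>s. pairing A (K s)) has_real_derivative poisson_R (\<lambda>X. pairing A X) H (K t)) (at t within I)"
          using motion t smooth_pairing[of A] unfolding hamiltonian_motion_def by blast
        then show ?thesis
          unfolding poisson_R_eq grad_pairing has_real_derivative_iff_has_vector_derivative .
      qed
      ultimately show ?thesis
        using vector_derivative_unique_within[OF nontrivial] by (metis pairing_commute)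
    qed
    then have "V = hamiltonian_field H (K t)"
      by (rule pairing_nondegenerate)
    with V show "(K has_vector_derivative hamiltonian_field H (K t)) (at t within I)"
      by simp
  qed
next
  assume ode: "\<forall>t\<in>I. (K has_vector_derivative hamiltonian_field H (K t)) (at t within I)"
  show "hamiltonian_motion H I K"
    unfolding hamiltonian_motion_def
  proof (intro ballI conjI allI impI)
    fix t
    assume t: "t \<in> I"
    from ode t have K': "(K has_vector_derivative hamiltonian_field H (K t)) (at t within I)"
      by simp
    then show "K differentiable (at t within I)"
      by (rule differentiableI_vector)
    fix F :: "hs \<Rightarrow> real"
    assume "smooth F"
    from has_derivative_compose[OF K'[unfolded has_vector_derivative_def] smooth_has_derivative_grad[OF this]]
    show "((\<lambda>s. F (K s)) has_real_derivative poisson_R F H (K t)) (at t within I)"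
      by (simp add: has_field_derivative_def poisson_R_eq pairing.scaleR_right
          mult.commute[of _ "pairing _ _"])
  qed
qed

lemma poisson_R_H_fun:
  assumes "i \<ge> 1" "j \<ge> 1"
  shows "poisson_R (H_fun i) (H_fun j) K = 0"
proof -
  have "pairing (hs_power K i) (bracket (proj_l (hs_power K j)) K) =
      pairing (bracket K (hs_power K i)) (proj_l (hs_power K j))"
    by (metis pairing_commute pairing_bracket)
  also have "\<dots> = 0"
    by (simp add: bracket_hs_power[OF assms(1)] pairing.zero_left)
  finally show ?thesis
    by (simp add: poisson_R_eq grad_H_fun[OF assms(1)] hamiltonian_field_H_fun[OF assms(2)]
        pairing.scaleR_left pairing.scaleR_right)
qed

theorem proposition2p4:
  shows
    "(\<forall>F (I :: real set) K. smooth F \<and> is_interval I \<and> interior I \<noteq> {} \<longrightarrow>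
        (hamiltonian_motion F I K \<longleftrightarrow>
          (\<forall>t\<in>I. (K has_vector_derivative
             ((1/2) *\<^sub>R bracket (R_op (grad F (K t))) (K t)
               - (1/2) *\<^sub>R dual_map R_op (bracket (K t) (grad F (K t))))) (at t within I))))
     \<and> (\<forall>j\<ge>1. smooth (H_fun j) \<and>
        (\<forall>(I :: real set) K. is_interval I \<and> interior I \<noteq> {} \<longrightarrow>
          (hamiltonian_motion (H_fun j) I K \<longleftrightarrow>
            (\<forall>t\<in>I. (K has_vector_derivative
               ((1/2) *\<^sub>R bracket (proj_l (hs_power (K t) j)) (K t))) (at t within I)))))
     \<and> (\<forall>i\<ge>1. \<forall>j\<ge>1. \<forall>K. poisson_R (H_fun i) (H_fun j) K = 0)"
proof (intro conjI allI impI; (elim conjE)?)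
  fix F :: "hs \<Rightarrow> real" and I :: "real set" and K
  assume "smooth F" "is_interval I" "interior I \<noteq> {}"
  from hamiltonian_motion_iff[OF this] show "hamiltonian_motion F I K \<longleftrightarrow>
      (\<forall>t\<in>I. (K has_vector_derivative
         ((1/2) *\<^sub>R bracket (R_op (grad F (K t))) (K t)
           - (1/2) *\<^sub>R dual_map R_op (bracket (K t) (grad F (K t))))) (at t within I))"
    unfolding hamiltonian_field_def .
next
  fix j :: nat
  assume j: "j \<ge> 1"
  then show "smooth (H_fun j)"
    by (rule smooth_H_fun)
  fix I :: "real set" and K
  assume "is_interval I" "interior I \<noteq> {}"
  from hamiltonian_motion_iff[OF smooth_H_fun[OF j] this]
  show "hamiltonian_motion (H_fun j) I K \<longleftrightarrow>
      (\<forall>t\<in>I. (K has_vector_derivative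
         ((1/2) *\<^sub>R bracket (proj_l (hs_power (K t) j)) (K t))) (at t within I))"
    unfolding hamiltonian_field_H_fun[OF j] .
qed (rule poisson_R_H_fun)

end
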